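(* Fix an integer $d\ge 2$. Let $\mathcal D$ be a distribution on $\mathbb S^{d-1}\times\mathbb R$ whose $x$-marginal is the uniform distribution on $\mathbb S^{d-1}$ and with $y=f^*(x)+\xi$, where $f^*\in L^2(\mathbb S^{d-1})$ is fixed (independent of $m$) and $\xi$ is independent noise with mean $0$ and variance $\sigma^2>0$. For each sample size $m$ let $\tau_m>0$ and consider the Gaussian kernel $K_m(x,t)=\exp(-\|x-t\|_2^2/\tau_m^2)$. Let $\tilde R(\hat f_0)$ denote the predicted risk of the minimum-norm interpolant (defined in the context) for kernel $K_m$ and sample size $m$, and let $\tilde R(0)=\sigma^2+\|f^*\|^2$. Then: 1. If $\tau_m=o(m^{-1/(d-1)})$, then $\tilde R(0)\le\liminf_{m\to\infty}\tilde R(\hat f_0)\le\limsup_{m\to\infty}\tilde R(\hat f_0)<\infty$. More precisely, there is a scalar $c_d$ depending only on $d$ such that, whenever $\tau_m\le m^{-1/(d-1)}t(m)$ with $t(m)\to0$ as $m\to\infty$, there is $m_0$ (depending on $t$) such that for all $m>m_0$, $\tilde R(\hat f_0)>\sigma^2+(1-c_d\,t(m)^{(d-1)/2})\|f^*\|^2$. 2. If $\tau_m=\omega(m^{-1/(d-1)})$, then $\lim_{m\to\infty}\tilde R(\hat f_0)=\infty$; hence for all large enough $m$, $\tilde R(\hat f_0)>\tilde R(0)$. 3. If $\tau_m=\Theta(m^{-1/(d-1)})$, then $\limsup_{m\to\infty}\tilde R(\hat f_0)<\infty$. Moreover, if $C_1m^{-1/(d-1)}\le\tau_m\le C_2m^{-1/(d-1)}$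 for all $m$, for constants $C_1,C_2>0$, then there exist $\eta,\mu>0$ depending only on $d,C_1,C_2$ such that for all $m$, $\tilde R(\hat f_0)>\mu\|f^*\|^2+(1+\eta)\sigma^2$. Consequently $\tilde R(\hat f_0)>\tilde R(0)$ whenever $\sigma^2>\frac{1-\mu}{\eta}\|f^*\|^2$.
   Context: Eigenframework (predicted risk). For a positive semi-definite kernel $K$ on $\mathcal X$ and the $x$-marginal $\mu$ of the data, write Mercer's decomposition $K(x,t)=\sum_{i\ge1}\lambda_i\phi_i(x)\phi_i(t)$, where $\lambda_1\ge\lambda_2\ge\dots>0$ are the eigenvalues (listed with multiplicity) of the integral operator $f\mapsto\int K(\cdot,t)f(t)\,d\mu(t)$ on $L^2(\mu)$ and $\{\phi_i\}$ is the corresponding orthonormal eigenbasis. Expand $f^*=\sum_i\beta_i\phi_i$, so $\|f^*\|^2:=\|\beta\|_2^2=\mathbb E_\mu[f^*(x)^2]$. For sample size $m$, let $\kappa_0>0$ solve $\sum_i\frac{\lambda_i}{\lambda_i+\kappa_0}=m$, let $\mathcal L_i=\frac{\lambda_i}{\lambda_i+\kappa_0}$ and $\mathcal E_0=\frac{m}{m-\sum_i\mathcal L_i^2}$. The predicted test risk of the minimum-norm interpolating (ridgeless) kernel regression solution $\hat f_0$ is $\tilde R(\hat f_0)=\mathcal E_0\big(\sum_i(1-\mathcal L_i)^2\beta_i^2+\sigma^2\big)$, and the risk of the null predictor is $\tilde R(0)=\sigma^2+\|f^*\|^2$. For the Gaussian kernel with bandwidth $\tau$ and $\mu$ uniform on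 $\mathbb S^{d-1}$, the eigenfunctions are the spherical harmonics; the degree-$k$ harmonics ($k\ge0$) share the eigenvalue $e^{-2/\tau^2}\tau^{d-2}I_{k+d/2-1}(2/\tau^2)\Gamma(d/2)$ (with $I_v$ the modified Bessel function of the first kind), with multiplicity $N(d,k)=\frac{(2k+d-2)(k+d-3)!}{k!(d-2)!}$. *)

theory Defs
  imports "HOL-Analysis.Analysis" "HOL-Library.Landau_Symbols" "HOL-Library.Liminf_Limsup"
begin

definition besselI :: "real \<Rightarrow> real \<Rightarrow> real" where
  "besselI v x = (\<Sum>n. (x / 2) powr (2 * real n + v) / (fact n * Gamma (real n + v + 1)))"

text \<open>Multiplicity N(d,k) of degree-k spherical harmonics on S^(d-1).
  For k = 0 the value is 1 (the factorial formula gives 1 for d \<ge> 3 and is the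
  standard convention for d = 2).\<close>
definition harm_mult :: "nat \<Rightarrow> nat \<Rightarrow> nat" where
  "harm_mult d k = (if k = 0 then 1
     else ((2 * k + d - 2) * fact (k + d - 3)) div (fact k * fact (d - 2)))"

text \<open>Eigenvalue shared by the degree-k harmonics for the Gaussian kernel of bandwidth tau.\<close>
definition gauss_eig :: "nat \<Rightarrow> real \<Rightarrow> nat \<Rightarrow> real" where
  "gauss_eig d tau k = exp (- 2 / tau\<^sup>2) * tau ^ (d - 2)
      * besselI (real k + real d / 2 - 1) (2 / tau\<^sup>2) * Gamma (real d / 2)"

definition harm_idx :: "nat \<Rightarrow> (nat \<times> nat) set" where
  "harm_idx d = {(k, j). j < harm_mult d k}"

text \<open>f* is represented by its coefficients beta k j in the spherical-harmonic eigenbasis.\<close>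
definition fnorm_sq :: "nat \<Rightarrow> (nat \<Rightarrow> nat \<Rightarrow> real) \<Rightarrow> real" where
  "fnorm_sq d beta = infsum (\<lambda>(k, j). (beta k j)\<^sup>2) (harm_idx d)"

definition kappa0 :: "nat \<Rightarrow> real \<Rightarrow> nat \<Rightarrow> real" where
  "kappa0 d tau m = (THE \<kappa>. \<kappa> > 0 \<and>
      infsum (\<lambda>(k, j). gauss_eig d tau k / (gauss_eig d tau k + \<kappa>)) (harm_idx d) = real m)"

definition learnability :: "nat \<Rightarrow> real \<Rightarrow> nat \<Rightarrow> nat \<Rightarrow> real" where
  "learnability d tau m k = gauss_eig d tau k / (gauss_eig d tau k + kappa0 d tau m)"

definition overfit_coeff :: "nat \<Rightarrow> real \<Rightarrow> nat \<Rightarrow> real" where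
  "overfit_coeff d tau m = real m /
     (real m - infsum (\<lambda>(k, j). (learnability d tau m k)\<^sup>2) (harm_idx d))"

definition pred_risk :: "nat \<Rightarrow> real \<Rightarrow> nat \<Rightarrow> (nat \<Rightarrow> nat \<Rightarrow> real) \<Rightarrow> real \<Rightarrow> real" where
  "pred_risk d tau m beta sigma2 = overfit_coeff d tau m *
     (infsum (\<lambda>(k, j). (1 - learnability d tau m k)\<^sup>2 * (beta k j)\<^sup>2) (harm_idx d) + sigma2)"

definition null_risk :: "nat \<Rightarrow> (nat \<Rightarrow> nat \<Rightarrow> real) \<Rightarrow> real \<Rightarrow> real" where
  "null_risk d beta sigma2 = sigma2 + fnorm_sq d beta"

definition admissible :: "nat \<Rightarrow> (nat \<Rightarrow> nat \<Rightarrow> real) \<Rightarrow> real \<Rightarrow> (nat \<Rightarrow> real) \<Rightarrow> bool" where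
  "admissible d beta sigma2 tau \<longleftrightarrow>
     (\<lambda>(k, j). (beta k j)\<^sup>2) summable_on harm_idx d \<and> sigma2 > 0 \<and> (\<forall>m. tau m > 0)"

end

theory Submission
  imports Defs
begin

text \<open>
  With x = 2 / tau^2 and v = k + d/2 - 1, the ratio of consecutive eigenvalues is
  I_(v+1)(x) / I_v(x), and the Bessel recurrence traps it between x / (x + 2(v+1)) and x / (x + v).
  Hence the spectrum is flat up to degree about 1/tau and decays geometrically beyond, while the
  multiplicities up to degree K add up to order K^(d-1). Everything is then a comparison of 1/tau
  with r = m^(1/(d-1)).

  If tau r is small, far more than m eigenvalues are comparable to the largest one, so the largest
  learnability L_0 is of order (tau r)^(d-1); since the overfitting coefficient lies between 1 and
  1/(1 - L_0), the risk tends to the null risk. If tau r is bounded above and below, kappa_0 is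
  comparable to the largest eigenvalue, so L_0 stays away from 1 while a positive fraction of the
  m degrees of freedom has learnability bounded below. If tau r is large, the eigenvalues halve over
  2/tau degrees, a vanishing fraction of r, so the learnabilities drop from near 1 to near 0 in a
  thin window, the sum of L(1 - L) is o(m), and the overfitting coefficient diverges.
\<close>

section \<open>Ratios of modified Bessel functions\<close>

text \<open>Consecutive terms have ratio \<open>(x/2)\<^sup>2 / ((n + 1) * (n + v + 1))\<close>,
  which is at most 1/2 as soon as \<open>n \<ge> x\<^sup>2\<close>.\<close>

lemma besselI_summable:
  assumes "v \<ge> 0" "x > 0"
  shows "summable (\<lambda>n. (x / 2) powr (2 * real n + v) / (fact n * Gamma (real n + v + 1)))" (is "summable ?a")
proof (rule summable_ratio_test[where c = "1/2" and N = "nat \<lceil>x\<^sup>2\<rceil>"])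
  fix n assume n: "nat \<lceil>x\<^sup>2\<rceil> \<le> n"
  have G: "Gamma (real n + v + 2) = (real n + v + 1) * Gamma (real n + v + 1)"
    using Gamma_plus1[of "real n + v + 1"] assms nonpos_Ints_nonpos[of "real n + v + 1"]
    by (force simp: add_ac)
  have Gp: "Gamma (real n + v + 1) > 0"
    using assms by (intro Gamma_real_pos) auto
  have pw: "(x/2) powr (2 * real (Suc n) + v) = (x/2)\<^sup>2 * (x/2) powr (2 * real n + v)"
    using assms by (simp add: powr_add[symmetric] flip: powr_numeral) (simp add: algebra_simps)
  have "?a (Suc n) = (x/2)\<^sup>2 / ((real n + 1) * (real n + v + 1)) * ?a n"
    unfolding pw using G Gp assms by (simp add: add_ac)
  moreover have "(x/2)\<^sup>2 / ((real n + 1) * (real n + v + 1)) \<le> 1 / 2"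
  proof -
    have "x\<^sup>2 \<le> real n" using n by linarith
    also have "real n \<le> (real n + 1) * (real n + v + 1)"
      using assms by (simp add: algebra_simps)
    finally have "x\<^sup>2 \<le> (real n + 1) * (real n + v + 1)" .
    moreover have P: "(real n + 1) * (real n + v + 1) > 0"
      using assms by (intro mult_pos_pos) auto
    ultimately have "(x/2)\<^sup>2 \<le> (real n + 1) * (real n + v + 1) / 2"
      unfolding power_divide by (simp add: field_simps)
    then show ?thesis using P by (subst pos_divide_le_eq) auto
  qed
  moreover have "?a n \<ge> 0" using Gp by simp
  ultimately have "?a (Suc n) \<le> 1/2 * ?a n" by (metis mult_right_mono)
  moreover have "?a (Suc n) \<ge> 0"
    using assms by (intro divide_nonneg_nonneg mult_nonneg_nonneg less_imp_le[OF Gamma_real_pos]) auto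
  ultimately show "norm (?a (Suc n)) \<le> 1/2 * norm (?a n)"
    using \<open>?a n \<ge> 0\<close> by (simp only: real_norm_def abs_of_nonneg)
qed auto

lemma besselI_pos:
  assumes "v \<ge> 0" "x > 0"
  shows "besselI v x > 0"
  unfolding besselI_def
proof (rule suminf_pos[OF besselI_summable[OF assms]])
  fix n
  have "Gamma (real n + v + 1) > 0" using assms by (intro Gamma_real_pos) auto
  then show "0 < (x/2) powr (2 * real n + v) / (fact n * Gamma (real n + v + 1))"
    using assms by simp
qed

text \<open>The identity holds term by term after a shift: the n-th terms of \<open>x * I_v\<close>
  and \<open>2 * (v + 1) * I_(v+1)\<close> differ by a term with a factor n, which vanishes at n = 0
  and whose value at n + 1 is x times the n-th term of \<open>I_(v+2)\<close>.\<close>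

lemma besselI_rec:
  assumes "v \<ge> 0" "x > 0"
  shows "x * besselI v x = x * besselI (v + 2) x + 2 * (v + 1) * besselI (v + 1) x"
proof -
  define a where "a v n = (x / 2) powr (2 * real n + v) / (fact n * Gamma (real n + v + 1))" for v n
  have sm: "summable (a u)" if "u \<ge> 0" for u
    using besselI_summable[OF that assms(2)] by (simp add: a_def[abs_def])
  have bes: "besselI u x = suminf (a u)" for u by (simp add: besselI_def a_def[abs_def])
  have Gp: "Gamma (real n + v + 1) > 0" for n
    using assms by (intro Gamma_real_pos) auto
  have G: "Gamma (real n + v + 2) = (real n + v + 1) * Gamma (real n + v + 1)" for n
    using Gamma_plus1[of "real n + v + 1"] assms nonpos_Ints_nonpos[of "real n + v + 1"]
    by (force simp: add_ac)
  have pw1: "(x/2) powr (2 * real n + (v + 1)) = (x/2) * (x/2) powr (2 * real n + v)" for n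
    using assms by (simp add: powr_add)
  have step: "x * a v n - 2 * (v + 1) * a (v + 1) n =
      x * ((x / 2) powr (2 * real n + v) * real n / (fact n * Gamma (real n + v + 2)))" for n
  proof -
    have e: "real n + (v + 1) + 1 = real n + v + 2" by simp
    show ?thesis
      unfolding a_def pw1 e G using Gp[of n] assms
      by (simp add: divide_simps add_nonneg_pos) (auto simp: algebra_simps)
  qed
  have z: "x * a v 0 - 2 * (v + 1) * a (v + 1) 0 = 0"
    using step[of 0] by simp
  have s: "x * a v (Suc n) - 2 * (v + 1) * a (v + 1) (Suc n) = x * a (v + 2) n" for n
  proof -
    have e: "2 * real (Suc n) + v = 2 * real n + (v + 2)" "real (Suc n) + v + 2 = real n + (v + 2) + 1"
      by simp_all
    have "Gamma (real n + (v + 2) + 1) > 0" using assms by (intro Gamma_real_pos) auto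
    then show ?thesis unfolding step unfolding a_def e
      by (simp add: divide_simps add_nonneg_pos)
  qed
  have sD: "summable (\<lambda>n. x * a v n - 2 * (v + 1) * a (v + 1) n)"
    using assms by (intro summable_diff summable_mult sm) auto
  have "x * suminf (a v) - 2 * (v + 1) * suminf (a (v + 1)) = (\<Sum>n. x * a v n - 2 * (v + 1) * a (v + 1) n)"
    using assms by (subst suminf_diff[symmetric]) (auto intro!: summable_mult sm simp: suminf_mult sm)
  also have "\<dots> = (\<Sum>n. x * a (v + 2) n)"
    using suminf_split_head[OF sD] z s by simp
  also have "\<dots> = x * suminf (a (v + 2))" using assms by (intro suminf_mult sm) auto
  finally show ?thesis by (simp add: bes)
qed

text \<open>Downward induction on v in steps of 2: for v + 2 \<ge> x the bound is immediate from the recurrence,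
  and the recurrence used twice carries it from v + 2 to v.\<close>

lemma besselI_ratio_le:
  assumes "v \<ge> 0" "x > 0"
  shows "(x + v) * besselI (v + 1) x \<le> x * besselI v x"
proof -
  have "\<forall>v\<ge>0. v + 2 * real n + 2 \<ge> x \<longrightarrow> (x + v) * besselI (v + 1) x \<le> x * besselI v x" for n
  proof (induction n)
    case 0
    show ?case
    proof (intro allI impI)
      fix v :: real assume v: "v \<ge> 0" "v + 2 * real 0 + 2 \<ge> x"
      have "(x + v) * besselI (v + 1) x \<le> 2 * (v + 1) * besselI (v + 1) x"
        using v besselI_pos[of "v + 1" x] assms by (intro mult_right_mono) auto
      also have "\<dots> \<le> x * besselI v x"
        using besselI_rec[of v x] v besselI_pos[of "v + 2" x] assms by simp
      finally show "(x + v) * besselI (v + 1) x \<le> x * besselI v x" .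
    qed
  next
    case (Suc n)
    show ?case
    proof (intro allI impI)
      fix v :: real assume v: "v \<ge> 0" "v + 2 * real (Suc n) + 2 \<ge> x"
      define w where "w = v + 2"
      define b c e where "b = besselI (v + 1) x" and "c = besselI w x" and "e = besselI (w + 1) x"
      have w: "w > 0" using v by (simp add: w_def)
      have c: "c > 0" using besselI_pos[of w x] w assms by (simp add: c_def)
      have b: "b > 0" using besselI_pos[of "v+1" x] v assms by (simp add: b_def)
      have U: "(x + w) * e \<le> x * c"
        using Suc.IH[rule_format, of w] v w by (simp add: e_def c_def w_def)
      have r: "x * b = x * e + 2 * w * c"
        using besselI_rec[of "v + 1" x] v assms by (simp add: b_def c_def e_def w_def add_ac)
      \<comment> \<open>This is the claim for v after \<open>I_v\<close> is eliminated by the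
        recurrence. Rewriting b by \<open>r\<close> and bounding e by \<open>U\<close> leaves a
        slack of \<open>2 * w ^ 3 * c\<close>.\<close>
      have "(x - w) * b \<le> x * c"
      proof (cases "x \<le> w")
        case True
        then have "(x - w) * b \<le> 0" using b by (simp add: mult_nonpos_nonneg)
        also have "0 \<le> x * c" using c assms by simp
        finally show ?thesis .
      next
        case False
        have "x * ((x + w) * ((x - w) * b)) = (x + w) * (x - w) * (x * b)"
          by (simp only: mult_ac)
        also have "\<dots> = (x + w) * (x - w) * (x * e + 2 * w * c)" unfolding r ..
        also have "(x + w) * (x - w) * (x * e + 2 * w * c) = (x - w) * x * ((x + w) * e) + (x - w) * (x + w) * 2 * w * c"
          by (simp add: algebra_simps)
        also have "\<dots> \<le> (x - w) * x * (x * c) + (x - w) * (x + w) * 2 * w * c"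
          using U False assms by (intro add_right_mono mult_left_mono) auto
        also have "\<dots> = x * ((x + w) * (x * c)) - 2 * w ^ 3 * c"
          by (simp add: algebra_simps power3_eq_cube)
        also have "\<dots> \<le> x * ((x + w) * (x * c))" using w c by simp
        finally show ?thesis using assms w by simp
      qed
      then show "(x + v) * besselI (v + 1) x \<le> x * besselI v x"
        using besselI_rec[of v x] v assms by (simp add: b_def c_def w_def algebra_simps)
    qed
  qed
  from this[of "nat \<lceil>x\<rceil>", rule_format, OF assms(1)] show ?thesis
    using assms by linarith
qed

text \<open>The bound just proved, at order v + 1, gives \<open>I_(v+2) \<le> I_(v+1)\<close>; put
  into the recurrence, this bounds \<open>I_v\<close> from above.\<close>

lemma besselI_ratio_ge:
  assumes "v \<ge> 0" "x > 0"
  shows "x * besselI v x \<le> (x + 2 * (v + 1)) * besselI (v + 1) x"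
proof -
  have "x * besselI (v + 2) x \<le> (x + (v + 1)) * besselI (v + 2) x"
    using besselI_pos[of "v + 2" x] assms by (intro mult_right_mono) auto
  also have "\<dots> \<le> x * besselI (v + 1) x"
    using besselI_ratio_le[of "v + 1" x] assms by (simp add: add_ac)
  finally show ?thesis using besselI_rec[OF assms] by (simp add: algebra_simps)
qed

section \<open>Eigenvalues and multiplicities\<close>

lemma gauss_eig_pos:
  assumes "d \<ge> 2" "tau > 0"
  shows "gauss_eig d tau k > 0"
  using assms besselI_pos[of "real k + real d / 2 - 1" "2 / tau\<^sup>2"]
  by (simp add: gauss_eig_def Gamma_real_pos)

text \<open>The two Bessel ratio bounds at \<open>x = 2 / tau\<^sup>2\<close>, slightly weakened: v
  is lowered to k in the first, and \<open>v + 1 = k + d/2\<close> is raised to k + d in the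
  second.\<close>

lemma gauss_eig_Suc_bounds:
  assumes "d \<ge> 2" "tau > 0"
  shows "gauss_eig d tau (Suc k) * (1 + real k * tau\<^sup>2 / 2) \<le> gauss_eig d tau k"
    and "gauss_eig d tau k \<le> gauss_eig d tau (Suc k) * (1 + (real k + real d) * tau\<^sup>2)"
proof -
  define v x where "v = real k + real d / 2 - 1" and "x = 2 / tau\<^sup>2"
  define A where "A = exp (- 2 / tau\<^sup>2) * tau ^ (d - 2) * Gamma (real d / 2)"
  have x: "x > 0" and v: "v \<ge> 0" and vk: "v \<ge> real k" and A: "A > 0"
    using assms by (auto simp: x_def v_def A_def Gamma_real_pos)
  have g0: "gauss_eig d tau k = A * besselI v x"
    by (simp add: gauss_eig_def A_def v_def x_def)
  have "real (Suc k) + real d / 2 - 1 = v + 1" by (simp add: v_def)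
  then have g1: "gauss_eig d tau (Suc k) = A * besselI (v + 1) x"
    by (simp only: gauss_eig_def) (simp add: A_def x_def)
  have B: "besselI (v + 1) x > 0" using v x by (intro besselI_pos) auto
  have t: "tau\<^sup>2 = 2 / x" using assms by (simp add: x_def)
  have "besselI (v + 1) x * (x + real k) \<le> (x + v) * besselI (v + 1) x"
    using B vk by (simp add: mult_ac)
  also have "\<dots> \<le> x * besselI v x" by (rule besselI_ratio_le[OF v x])
  finally have "besselI (v + 1) x * (1 + real k / x) \<le> besselI v x"
    using x by (simp add: field_simps)
  then have "A * (besselI (v + 1) x * (1 + real k / x)) \<le> A * besselI v x"
    using A by (intro mult_left_mono) auto
  then show "gauss_eig d tau (Suc k) * (1 + real k * tau\<^sup>2 / 2) \<le> gauss_eig d tau k"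
    unfolding g0 g1 t by (simp add: mult_ac)
  have "x * besselI v x \<le> (x + 2 * (v + 1)) * besselI (v + 1) x" by (rule besselI_ratio_ge[OF v x])
  also have "\<dots> \<le> (x + 2 * (real k + real d)) * besselI (v + 1) x"
    using B assms by (intro mult_right_mono) (auto simp: v_def)
  finally have "besselI v x \<le> besselI (v + 1) x * (1 + 2 * (real k + real d) / x)"
    using x by (simp add: field_simps)
  then have "A * besselI v x \<le> A * (besselI (v + 1) x * (1 + 2 * (real k + real d) / x))"
    using A by (intro mult_left_mono) auto
  then show "gauss_eig d tau k \<le> gauss_eig d tau (Suc k) * (1 + (real k + real d) * tau\<^sup>2)"
    unfolding g0 g1 t by (simp add: mult_ac)
qed

text \<open>For k > 0 the quotient in \<open>harm_mult\<close> is the binomial coefficient times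
  \<open>(2 * k + d - 2) / (k + d - 2)\<close>, a factor in [1, 2]. Both bounds are natural numbers,
  so they survive the rounding of \<open>div\<close>.\<close>

lemma harm_mult_bounds:
  assumes "d \<ge> 2"
  shows "(k + d - 2) choose (d - 2) \<le> harm_mult d k"
    and "harm_mult d k \<le> 2 * ((k + d - 2) choose (d - 2))"
proof -
  have "(k + d - 2) choose (d - 2) \<le> harm_mult d k \<and> harm_mult d k \<le> 2 * ((k + d - 2) choose (d - 2))"
  proof (cases "k = 0")
    case True
    then show ?thesis by (simp add: harm_mult_def)
  next
    case False
    define C where "C = (k + d - 2) choose (d - 2)"
    define D :: nat where "D = fact k * fact (d - 2)"
    define F :: nat where "F = fact (k + d - 3)"
    have D: "D > 0" by (simp add: D_def)
    have s: "k + d - 2 = Suc (k + d - 3)" "k + d - 2 - (d - 2) = k" using False assms by auto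
    have "D * C = fact (k + d - 2)"
      using binomial_fact_lemma[of "d - 2" "k + d - 2"] s assms by (simp add: C_def D_def mult_ac)
    also have "\<dots> = (k + d - 2) * F" unfolding s(1) F_def fact_Suc by simp
    finally have DC: "D * C = (k + d - 2) * F" .
    have hm: "harm_mult d k = (2 * k + d - 2) * F div D"
      using False by (simp add: harm_mult_def D_def F_def)
    have "(k + d - 2) * F \<le> (2 * k + d - 2) * F" by (intro mult_right_mono) auto
    then have "C * D \<le> (2 * k + d - 2) * F" using DC by (simp add: mult.commute)
    then have 1: "C \<le> harm_mult d k" unfolding hm using D by (simp add: less_eq_div_iff_mult_less_eq)
    have "(2 * k + d - 2) * F \<le> 2 * (k + d - 2) * F" using assms by (intro mult_right_mono) auto
    also have "\<dots> = (2 * C) * D" using DC by (simp add: mult_ac)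
    finally have 2: "harm_mult d k \<le> 2 * C" unfolding hm using D
      by (metis div_le_mono div_mult_self_is_m)
    show ?thesis using 1 2 by (simp add: C_def)
  qed
  then show "(k + d - 2) choose (d - 2) \<le> harm_mult d k"
    and "harm_mult d k \<le> 2 * ((k + d - 2) choose (d - 2))" by auto
qed

text \<open>The hockey-stick identity sums the binomial lower bounds to
  \<open>(K + d - 1) choose (d - 1)\<close>, and \<open>n choose k\<close> is at least
  \<open>(n / k) ^ k\<close>.\<close>

lemma sum_harm_mult_ge:
  assumes "d \<ge> 2"
  shows "((real K + 1) / (real d - 1)) ^ (d - 1) \<le> (\<Sum>k\<le>K. real (harm_mult d k))"
proof -
  have "((real K + 1) / (real d - 1)) ^ (d - 1) \<le> (real (K + d - 1) / real (d - 1)) ^ (d - 1)"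
    using assms by (intro power_mono divide_right_mono) (auto simp: of_nat_diff divide_right_mono)
  also have "\<dots> \<le> real ((K + d - 1) choose (d - 1))"
    by (rule binomial_ge_n_over_k_pow_k) auto
  also have "(K + d - 1) choose (d - 1) = (\<Sum>k\<le>K. (k + d - 2) choose (d - 2))"
  proof -
    have "(\<Sum>k\<le>K. (k + r) choose r) = Suc (K + r) choose Suc r" for r
      by (induction K) auto
    from this[of "d - 2"] show ?thesis using assms by (auto simp: Suc_diff_le numeral_2_eq_2 Suc_diff_Suc)
  qed
  also have "real \<dots> \<le> real (\<Sum>k\<le>K. harm_mult d k)"
    by (intro of_nat_mono sum_mono harm_mult_bounds assms)
  finally show ?thesis by simp
qed

section \<open>Summation tools\<close>

lemma negative_binomial_sum_le:
  fixes y :: real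
  assumes "0 \<le> y" "y < 1"
  shows "(\<Sum>k<n. real ((k + r) choose r) * y ^ k) \<le> 1 / (1 - y) ^ (r + 1)"
proof (induction r)
  case 0
  have "(1 - y) * (\<Sum>k<n. y ^ k) = 1 - y ^ n"
    using one_diff_power_eq[of y n] by simp
  also have "\<dots> \<le> 1" using assms by simp
  finally show ?case using assms by (simp add: field_simps)
next
  case (Suc r)
  define T where "T r n = (\<Sum>k<n. real ((k + r) choose r) * y ^ k)" for r n
  \<comment> \<open>Summation by parts with Pascal's rule: multiplying by 1 - y lowers r by one up
    to a boundary term, kept here so that the induction on n closes and dropped afterwards by its
    sign.\<close>
  have "(1 - y) * T (Suc r) n \<le> T r n - y ^ n * real ((n + r) choose Suc r)"
  proof (induction n)
    case 0
    then show ?case by (simp add: T_def)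
  next
    case (Suc n)
    have "(1 - y) * T (Suc r) (Suc n) = (1 - y) * T (Suc r) n + (1 - y) * real ((n + Suc r) choose Suc r) * y ^ n"
      by (simp add: T_def algebra_simps)
    also have "\<dots> \<le> T r n - y ^ n * real ((n + r) choose Suc r) + (1 - y) * real ((n + Suc r) choose Suc r) * y ^ n"
      using Suc by simp
    also have "\<dots> = T r (Suc n) - y ^ Suc n * real ((Suc n + r) choose Suc r)"
      by (simp add: T_def algebra_simps)
    finally show ?case .
  qed
  also have "\<dots> \<le> T r n" using assms by simp
  also have "\<dots> \<le> 1 / (1 - y) ^ (r + 1)" using Suc by (simp add: T_def)
  finally have "(1 - y) * T (Suc r) n \<le> 1 / (1 - y) ^ (r + 1)" .
  then have "T (Suc r) n \<le> 1 / (1 - y) ^ (r + 1) / (1 - y)"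
    using assms by (subst pos_le_divide_eq) (auto simp: mult.commute)
  then show ?case by (simp add: T_def mult.commute)
qed

text \<open>The sum telescopes to the first D values minus the D values from n on, so the bound does
  not grow with n.\<close>

lemma sum_shift_diff_le:
  fixes f :: "nat \<Rightarrow> real"
  assumes "\<And>k. 0 \<le> f k" "\<And>k. f k \<le> 1"
  shows "(\<Sum>k<n. f k - f (k + D)) \<le> real D"
proof -
  have "(\<Sum>k<n. f k - f (k + D)) = (\<Sum>k<D. f k) - (\<Sum>k<D. f (k + n))"
  proof (induction n)
    case (Suc n)
    have "(\<Sum>k<D. f (k + n) - f (Suc k + n)) = f n - f (D + n)"
      using sum_lessThan_telescope'[of "\<lambda>k. f (k + n)" D] by simp
    then show ?case using Suc by (simp add: sum_subtractf add_ac)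
  qed simp
  also have "\<dots> \<le> (\<Sum>k<D. f k)" using assms by (simp add: sum_nonneg)
  also have "\<dots> \<le> (\<Sum>k<D. 1)" using assms by (intro sum_mono) auto
  finally show ?thesis by simp
qed

text \<open>Sums in the eigenframework run over pairs of degree and index; for summands depending on
  the degree alone this turns them into ordinary series weighted by multiplicity.\<close>

lemma has_sum_harm_idx:
  fixes f :: "nat \<Rightarrow> real"
  assumes "\<And>k. f k \<ge> 0" "summable (\<lambda>k. real (harm_mult d k) * f k)"
  shows "((\<lambda>(k, j). f k) has_sum (\<Sum>k. real (harm_mult d k) * f k)) (harm_idx d)"
proof -
  define g where "g k = real (harm_mult d k) * f k" for k
  have gS: "(g has_sum suminf g) UNIV"
    using assms by (intro sums_nonneg_imp_has_sum summable_sums) (auto simp: g_def[abs_def])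
  have row: "(((\<lambda>j. (\<lambda>(k, j). f k) (k, j)) has_sum g k)) {..<harm_mult d k}" for k
    by (auto intro!: has_sum_finiteI simp: g_def)
  have idx: "harm_idx d = Sigma UNIV (\<lambda>k. {..<harm_mult d k})"
    by (auto simp: harm_idx_def)
  have "(\<lambda>(k, j). f k) summable_on Sigma UNIV (\<lambda>k. {..<harm_mult d k})"
    by (rule summable_on_SigmaI[OF row]) (use gS assms in \<open>auto simp: summable_on_def\<close>)
  from has_sum_SigmaI[OF row gS this] show ?thesis
    by (simp add: idx g_def[abs_def])
qed

lemma harm_mult_pos: "d \<ge> 2 \<Longrightarrow> harm_mult d k > 0"
  using harm_mult_bounds(1)[of d k] zero_less_binomial[of "d - 2" "k + d - 2"] by linarith

lemma fnorm_sq_nonneg: "fnorm_sq d beta \<ge> 0"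
  unfolding fnorm_sq_def by (intro infsum_nonneg) auto

section \<open>The spectrum at a fixed bandwidth\<close>

locale gauss_spectrum =
  fixes d :: nat and tau :: real
  assumes d: "d \<ge> 2" and tau: "tau > 0"
begin

abbreviation lam :: "nat \<Rightarrow> real" where "lam \<equiv> gauss_eig d tau"
abbreviation N :: "nat \<Rightarrow> real" where "N k \<equiv> real (harm_mult d k)"
abbreviation p :: nat where "p \<equiv> d - 1"

lemma p_pos: "p > 0" using d by simp

lemma lam_pos: "lam k > 0" by (rule gauss_eig_pos[OF d tau])

lemma lam_nonneg: "lam k \<ge> 0"
  using lam_pos[of k] by simp

lemma N_pos: "N k > 0" using harm_mult_pos[OF d] by simp

lemma N_le: "N k \<le> 2 * real ((k + (p - 1)) choose (p - 1))"
proof -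
  have "harm_mult d k \<le> 2 * ((k + (p - 1)) choose (p - 1))"
    using harm_mult_bounds(2)[OF d, of k] d by (simp add: numeral_2_eq_2)
  then have "N k \<le> real (2 * ((k + (p - 1)) choose (p - 1)))" by (rule of_nat_mono)
  then show ?thesis by simp
qed

lemma N_le_power: "N k \<le> 2 * (real k + real p) ^ (p - 1)"
proof -
  have "(k + (p - 1)) choose (p - 1) \<le> (k + (p - 1)) ^ (p - 1)" by (rule binomial_le_pow) simp
  also have "\<dots> \<le> (k + p) ^ (p - 1)" by (intro power_mono) auto
  finally have "real ((k + (p - 1)) choose (p - 1)) \<le> real ((k + p) ^ (p - 1))" by (rule of_nat_mono)
  then show ?thesis using N_le[of k] by simp
qed

lemma sum_N_ge: "((real K + 1) / real p) ^ p \<le> (\<Sum>k\<le>K. N k)"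
  using sum_harm_mult_ge[OF d, of K] d by (simp add: of_nat_diff)

text \<open>The guaranteed decay factor \<open>1 + k * tau\<^sup>2 / 2\<close> grows with k, so a
  rate s available at degree i persists at every later degree.\<close>

lemma lam_decay:
  assumes "s \<ge> 0" "s \<le> real i * tau\<^sup>2 / 2"
  shows "lam (i + n) * (1 + s) ^ n \<le> lam i"
proof (induction n)
  case (Suc n)
  have "1 + s \<le> 1 + real (i + n) * tau\<^sup>2 / 2"
    using assms by (simp add: distrib_right add_divide_distrib add_increasing2)
  then have "lam (Suc (i + n)) * (1 + s) \<le> lam (Suc (i + n)) * (1 + real (i + n) * tau\<^sup>2 / 2)"
    using lam_nonneg by (intro mult_left_mono) auto
  also have "\<dots> \<le> lam (i + n)" by (rule gauss_eig_Suc_bounds[OF d tau])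
  finally have "lam (Suc (i + n)) * (1 + s) * (1 + s) ^ n \<le> lam (i + n) * (1 + s) ^ n"
    using assms by (intro mult_right_mono) auto
  with Suc show ?case by (simp add: mult_ac)
qed simp

lemma lam_antimono: "i \<le> j \<Longrightarrow> lam j \<le> lam i"
  using lam_decay[of 0 i "j - i"] by simp

text \<open>Each degree costs at most a factor \<open>1 + q \<le> exp q\<close> with
  \<open>q = (k + d) * tau\<^sup>2\<close>, and these exponents add up to at most the one stated.
  For small tau the eigenvalues thus stay comparable to \<open>lam 0\<close> up to degree about
  \<open>1 / tau\<close>.\<close>

lemma lam_ge: "lam 0 * exp (- (tau\<^sup>2 * (real K * (real K + real d)))) \<le> lam K"
proof (induction K)
  case (Suc K)
  define q where "q = (real K + real d) * tau\<^sup>2"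
  have q: "q \<ge> 0" by (simp add: q_def)
  have "(real K + real d) * tau\<^sup>2 + real K * (real K + real d) * tau\<^sup>2
      = tau\<^sup>2 * ((real K + 1) * (real K + real d))" by (simp add: algebra_simps)
  also have "\<dots> \<le> tau\<^sup>2 * (real (Suc K) * (real (Suc K) + real d))"
    by (intro mult_left_mono mult_mono) auto
  finally have e: "exp (- (tau\<^sup>2 * (real (Suc K) * (real (Suc K) + real d))))
      \<le> exp (- (tau\<^sup>2 * (real K * (real K + real d)))) * exp (- q)"
    by (simp add: q_def mult_ac flip: exp_add)
  have "lam K \<le> lam (Suc K) * (1 + q)"
    using gauss_eig_Suc_bounds(2)[OF d tau] by (simp add: q_def)
  also have "\<dots> \<le> lam (Suc K) * exp q"
    using exp_ge_add_one_self[of q] lam_pos[of "Suc K"] by (intro mult_left_mono) auto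
  finally have 1: "lam K * exp (- q) \<le> lam (Suc K)" by (simp add: exp_minus field_simps)
  have "lam 0 * exp (- (tau\<^sup>2 * (real (Suc K) * (real (Suc K) + real d))))
      \<le> lam 0 * exp (- (tau\<^sup>2 * (real K * (real K + real d)))) * exp (- q)"
    using mult_left_mono[OF e, of "lam 0"] lam_pos[of 0] by (simp add: mult_ac)
  also have "\<dots> \<le> lam K * exp (- q)" using Suc by simp
  also note 1
  finally show ?case .
qed simp

text \<open>M is a degree scale and b a lower bound for \<open>(tau * M)\<^sup>2 / 2\<close>. From
  degree \<open>j * M\<close> on, the eigenvalues shrink by a factor \<open>1 + b * j / M\<close>
  per degree, so the negative binomial series controls the tail.\<close>

lemma lam_tail_sum_le:
  assumes M: "M > 0" and b: "b > 0" "b / real M ^ 2 \<le> tau\<^sup>2 / 2" and j: "j > 0"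
  shows "(\<Sum>k\<in>{j * M..<n}. N k * lam k)
     \<le> lam (j * M) * (2 * exp (b * real j * real j) * (1 + real M / (b * real j)) ^ p)"
proof -
  define c where "c = b * real j"
  define y where "y = 1 / (1 + c / real M)"
  have c: "c > 0" using b j by (simp add: c_def)
  have y: "0 \<le> y" "y < 1" using c M by (auto simp: y_def divide_simps add_pos_pos)
  have iy: "1 / (1 - y) = 1 + real M / c"
  proof -
    have "1 - y = c / (real M + c)" using c M by (simp add: y_def field_simps)
    then have "1 / (1 - y) = (real M + c) / c" by simp
    then show ?thesis using c by (simp add: field_simps)
  qed
  \<comment> \<open>Starting the geometric series at degree 0 instead of \<open>j * M\<close> costs
    this factor, whence the exponential in the bound.\<close>
  have "(1 + c / real M) ^ (j * M) \<le> exp (c / real M) ^ (j * M)"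
    using c M exp_ge_add_one_self[of "c / real M"] by (intro power_mono) auto
  also have "\<dots> = exp (c * real j)" using M by (simp flip: exp_of_nat_mult)
  finally have ey: "(1 + c / real M) ^ (j * M) \<le> exp (c * real j)" .
  have pt: "lam k \<le> lam (j * M) * exp (c * real j) * y ^ k" if "k \<ge> j * M" for k
  proof -
    have "c / real M = real (j * M) * (b / real M ^ 2)"
      using M by (simp add: c_def field_simps power2_eq_square)
    also have "\<dots> \<le> real (j * M) * (tau\<^sup>2 / 2)" using b by (intro mult_left_mono) auto
    finally have "lam (j * M + (k - j * M)) * (1 + c / real M) ^ (k - j * M) \<le> lam (j * M)"
      using c by (intro lam_decay) auto
    then have "lam k * (1 + c / real M) ^ (k - j * M) * (1 + c / real M) ^ (j * M)
        \<le> lam (j * M) * exp (c * real j)"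
      using that ey c M lam_pos[of "j * M"] by (intro mult_mono) auto
    then have "lam k * (1 + c / real M) ^ k \<le> lam (j * M) * exp (c * real j)"
      using that by (simp add: mult.assoc flip: power_add)
    then show ?thesis using c M by (simp add: y_def power_divide field_simps add_pos_pos)
  qed
  have "(\<Sum>k\<in>{j * M..<n}. N k * lam k)
     \<le> (\<Sum>k\<in>{j * M..<n}. (2 * real ((k + (p - 1)) choose (p - 1))) * (lam (j * M) * exp (c * real j) * y ^ k))"
    using lam_nonneg by (intro sum_mono mult_mono N_le pt) auto
  also have "\<dots> = lam (j * M) * exp (c * real j) * 2 * (\<Sum>k\<in>{j * M..<n}. real ((k + (p - 1)) choose (p - 1)) * y ^ k)"
    by (simp add: sum_distrib_left mult_ac)
  also have "\<dots> \<le> lam (j * M) * exp (c * real j) * 2 * (\<Sum>k<n. real ((k + (p - 1)) choose (p - 1)) * y ^ k)"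
    using lam_pos[of "j * M"] y by (intro mult_left_mono sum_mono2) auto
  also have "\<dots> \<le> lam (j * M) * exp (c * real j) * 2 * (1 / (1 - y) ^ (p - 1 + 1))"
    using lam_pos[of "j * M"] y by (intro mult_left_mono negative_binomial_sum_le) auto
  also have "1 / (1 - y) ^ (p - 1 + 1) = (1 + real M / c) ^ p"
  proof -
    have "p - 1 + 1 = p" using p_pos by simp
    then show ?thesis unfolding iy[symmetric] by (simp only: power_one_over)
  qed
  finally show ?thesis by (simp add: c_def mult_ac)
qed

lemma summable_N_lam: "summable (\<lambda>k. N k * lam k)"
proof -
  \<comment> \<open>The tail bound with j = M = 1 and \<open>b = tau\<^sup>2 / 2\<close>, which is
    independent of n.\<close>
  define C where "C = lam (1 * 1) * (2 * exp (tau\<^sup>2 / 2 * real 1 * real 1) * (1 + real 1 / (tau\<^sup>2 / 2 * real 1)) ^ p)"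
  have "(\<Sum>k<n. N k * lam k) \<le> N 0 * lam 0 + C" for n
  proof -
    have "(\<Sum>k<n. N k * lam k) \<le> (\<Sum>k\<in>insert 0 {1 * 1..<n}. N k * lam k)"
      using lam_nonneg by (intro sum_mono2) auto
    also have "\<dots> = N 0 * lam 0 + (\<Sum>k\<in>{1 * 1..<n}. N k * lam k)"
      by (subst sum.insert) auto
    also have "(\<Sum>k\<in>{1 * 1..<n}. N k * lam k) \<le> C"
      unfolding C_def using tau by (intro lam_tail_sum_le) auto
    finally show ?thesis by simp
  qed
  then show ?thesis
    using lam_nonneg by (intro summableI_nonneg_bounded[where x = "N 0 * lam 0 + C"]) auto
qed

section \<open>Effective dimension and the existence of kappa_0\<close>

lemma summable_N_learn:
  assumes "\<kappa> > 0"
  shows "summable (\<lambda>k. N k * (lam k / (lam k + \<kappa>)))"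
proof (rule summable_comparison_test')
  show "summable (\<lambda>k. N k * lam k * (1 / \<kappa>))"
    by (intro summable_mult2 summable_N_lam)
  fix k
  have "lam k / (lam k + \<kappa>) \<le> lam k / \<kappa>"
    using lam_pos[of k] assms by (intro divide_left_mono) auto
  then show "norm (N k * (lam k / (lam k + \<kappa>))) \<le> N k * lam k * (1 / \<kappa>)"
    using lam_pos[of k] assms mult_left_mono[of "lam k / (lam k + \<kappa>)" "lam k / \<kappa>" "N k"]
    by (simp add: abs_mult)
qed

text \<open>The effective dimension at ridge \<kappa>, grouped by degree; \<open>kappa0\<close> is
  the point where it equals m.\<close>

definition dof :: "real \<Rightarrow> real" where
  "dof \<kappa> = (\<Sum>k. N k * (lam k / (lam k + \<kappa>)))"

lemma dof_strict_antimono: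
  assumes "0 < \<kappa>" "\<kappa> < \<kappa>'"
  shows "dof \<kappa>' < dof \<kappa>"
proof -
  define D where "D k = N k * (lam k / (lam k + \<kappa>)) - N k * (lam k / (lam k + \<kappa>'))" for k
  have pos: "D k > 0" for k
  proof -
    have "lam k / (lam k + \<kappa>') < lam k / (lam k + \<kappa>)"
      using assms lam_pos[of k] by (intro divide_strict_left_mono) auto
    then show ?thesis using mult_strict_left_mono[OF _ N_pos] unfolding D_def by fastforce
  qed
  have "dof \<kappa> - dof \<kappa>' = suminf D"
    unfolding dof_def D_def[abs_def] using assms
    by (intro suminf_diff summable_N_learn) auto
  moreover have "suminf D > 0"
    using assms pos unfolding D_def[abs_def]
    by (intro suminf_pos summable_diff summable_N_learn) auto
  ultimately show ?thesis by simp
qed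

text \<open>Weierstrass test: the terms decrease in \<kappa>, so their values at the left endpoint
  dominate them.\<close>

lemma continuous_on_dof:
  assumes "a > 0"
  shows "continuous_on {a..b} dof"
proof -
  have "uniform_limit {a..b} (\<lambda>n \<kappa>. \<Sum>k<n. N k * (lam k / (lam k + \<kappa>))) dof sequentially"
    unfolding dof_def
  proof (rule Weierstrass_m_test)
    show "summable (\<lambda>k. N k * (lam k / (lam k + a)))" by (rule summable_N_learn[OF assms])
    fix k \<kappa> assume "\<kappa> \<in> {a..b}"
    then have "lam k / (lam k + \<kappa>) \<le> lam k / (lam k + a)" "lam k / (lam k + \<kappa>) \<ge> 0"
      using assms lam_pos[of k] by (auto intro!: divide_left_mono)
    then show "norm (N k * (lam k / (lam k + \<kappa>))) \<le> N k * (lam k / (lam k + a))"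
      unfolding norm_mult by (intro mult_mono) (auto simp: abs_of_nonneg simp del: abs_divide)
  qed
  moreover have "\<forall>\<^sub>F n in sequentially. continuous_on {a..b} (\<lambda>\<kappa>. \<Sum>k<n. N k * (lam k / (lam k + \<kappa>)))"
  proof (intro always_eventually allI continuous_intros ballI)
    fix \<kappa> k assume "\<kappa> \<in> {a..b}"
    then show "lam k + \<kappa> \<noteq> 0" using lam_pos[of k] assms by auto
  qed
  ultimately show ?thesis
    by (intro uniform_limit_theorem[where F = sequentially]) auto
qed

text \<open>Existence is the intermediate value theorem, uniqueness is strict monotonicity; together
  they give meaning to the definite description in \<open>kappa0\<close>.\<close>

lemma dof_surj:
  assumes "m > 0"
  shows "\<exists>!\<kappa>. \<kappa> > 0 \<and> dof \<kappa> = real m"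
proof -
  define T where "T = (\<Sum>k. N k * lam k)"
  have T: "T > 0" unfolding T_def
    using lam_pos N_pos by (intro suminf_pos summable_N_lam) auto
  \<comment> \<open>At ridge \<open>lam K\<close> each of the first K degrees contributes at least
    1/2, so \<open>K = 2 * m\<close> yields at least m. At ridge b,
    \<open>dof b \<le> T / b \<le> m\<close>; the maximum also ensures
    \<open>a \<le> b\<close>.\<close>
  define K where "K = 2 * m"
  define a b where "a = lam K" and "b = max a (T / real m)"
  have a: "a > 0" and b: "b > 0" using lam_pos by (auto simp: a_def b_def less_max_iff_disj)
  have "dof b \<le> (\<Sum>k. N k * lam k * (1 / b))"
    unfolding dof_def
  proof (intro suminf_le summable_N_learn b summable_mult2 summable_N_lam)
    fix k
    have "lam k / (lam k + b) \<le> lam k / b" using lam_pos[of k] b by (intro divide_left_mono) auto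
    from mult_left_mono[OF this, of "N k"]
    show "N k * (lam k / (lam k + b)) \<le> N k * lam k * (1 / b)" by simp
  qed
  also have "\<dots> = T / b" using suminf_mult2[OF summable_N_lam, of "1 / b"] by (simp add: T_def)
  also have "\<dots> \<le> real m"
  proof -
    have "T / real m \<le> b" by (simp add: b_def)
    then show ?thesis using b assms by (simp add: field_simps)
  qed
  finally have 1: "dof b \<le> real m" .
  have "real m \<le> (\<Sum>k<K. 1 / 2)" by (simp add: K_def)
  also have "\<dots> \<le> (\<Sum>k<K. N k * (lam k / (lam k + a)))"
  proof (intro sum_mono)
    fix k assume k: "k \<in> {..<K}"
    have "lam k \<ge> a" using k by (auto simp: a_def intro: lam_antimono)
    then have "1 / 2 \<le> lam k / (lam k + a)" using a by (simp add: field_simps)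
    moreover have "1 \<le> N k" using harm_mult_pos[OF d, of k] by simp
    ultimately have "1 * (1 / 2) \<le> N k * (lam k / (lam k + a))" by (intro mult_mono) auto
    then show "1 / 2 \<le> N k * (lam k / (lam k + a))" by simp
  qed
  also have "\<dots> \<le> dof a" unfolding dof_def
    using a lam_nonneg by (intro sum_le_suminf summable_N_learn) (auto simp: add_nonneg_nonneg)
  finally have 2: "real m \<le> dof a" .
  obtain \<kappa> where k: "a \<le> \<kappa>" "\<kappa> \<le> b" "dof \<kappa> = real m"
    using IVT2'[of dof b "real m" a] 1 2 continuous_on_dof[OF a] by (auto simp: b_def)
  show ?thesis
  proof (rule ex1I)
    show "\<kappa> > 0 \<and> dof \<kappa> = real m" using k a by auto
    fix \<kappa>' assume "\<kappa>' > 0 \<and> dof \<kappa>' = real m"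
    then show "\<kappa>' = \<kappa>"
      using dof_strict_antimono[of \<kappa> \<kappa>'] dof_strict_antimono[of \<kappa>' \<kappa>] k a
      by (cases \<kappa> \<kappa>' rule: linorder_cases) auto
  qed
qed

end

section \<open>Learnabilities and the overfitting coefficient\<close>

locale gauss_sample = gauss_spectrum +
  fixes m :: nat
  assumes m: "m > 0"
begin

abbreviation \<kappa> :: real where "\<kappa> \<equiv> kappa0 d tau m"
abbreviation L :: "nat \<Rightarrow> real" where "L \<equiv> learnability d tau m"

lemma kappa0_pos: "\<kappa> > 0" and dof_kappa0: "dof \<kappa> = real m"
proof -
  have "(\<lambda>k. infsum (\<lambda>(i, j). lam i / (lam i + k)) (harm_idx d)) k = dof k" if "k > 0" for k
    using that lam_nonneg
    unfolding dof_def
    by (intro infsumI has_sum_harm_idx summable_N_learn divide_nonneg_nonneg add_nonneg_nonneg) auto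
  then have "\<kappa> = (THE k. k > 0 \<and> dof k = real m)"
    unfolding kappa0_def by (intro arg_cong[where f = The] ext) auto
  with theI'[OF dof_surj[OF m]] show "\<kappa> > 0" "dof \<kappa> = real m" by auto
qed

lemma L_pos: "L k > 0" and L_less_1: "L k < 1"
  using lam_pos[of k] kappa0_pos by (auto simp: learnability_def)

lemma L_nonneg: "L k \<ge> 0"
  using L_pos[of k] by simp

lemma L_antimono: "i \<le> j \<Longrightarrow> L j \<le> L i"
  using lam_antimono[of i j] lam_pos[of i] lam_pos[of j] kappa0_pos
  by (simp add: learnability_def field_simps)

lemma N_L_sums: "(\<lambda>k. N k * L k) sums real m"
  using summable_sums[OF summable_N_learn[OF kappa0_pos]] dof_kappa0
  by (simp add: dof_def learnability_def)

lemma sum_N_L_le: "finite A \<Longrightarrow> (\<Sum>k\<in>A. N k * L k) \<le> real m"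
  using N_L_sums L_nonneg sum_le_suminf[of "\<lambda>k. N k * L k" A]
  by (auto simp: sums_iff)

lemma summable_N_L_sq: "summable (\<lambda>k. N k * (L k)\<^sup>2)"
proof (rule summable_comparison_test'[OF sums_summable[OF N_L_sums]])
  fix k
  have "(L k)\<^sup>2 \<le> L k * 1" unfolding power2_eq_square
    using L_pos[of k] L_less_1[of k] by (intro mult_left_mono) auto
  then show "norm (N k * (L k)\<^sup>2) \<le> N k * L k" by (simp add: mult_left_mono)
qed

definition dof2 :: real where "dof2 = (\<Sum>k. N k * (L k)\<^sup>2)"

lemma overfit_coeff_eq: "overfit_coeff d tau m = real m / (real m - dof2)"
proof -
  have "infsum (\<lambda>(k, j). (L k)\<^sup>2) (harm_idx d) = dof2"
    unfolding dof2_def by (intro infsumI has_sum_harm_idx summable_N_L_sq) auto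
  then show ?thesis by (simp add: overfit_coeff_def)
qed

text \<open>Each squared learnability is at most \<open>L 0\<close> times the learnability, and
  these sum to m. Bounding the overfitting coefficient from above thereby reduces to keeping
  \<open>L 0\<close> away from 1.\<close>

lemma dof2_le: "dof2 \<le> L 0 * real m"
proof -
  have "dof2 \<le> (\<Sum>k. L 0 * (N k * L k))"
    unfolding dof2_def
  proof (intro suminf_le summable_N_L_sq summable_mult sums_summable[OF N_L_sums])
    fix k
    have "L k * (N k * L k) \<le> L 0 * (N k * L k)"
      using L_antimono[of 0 k] L_pos[of k] by (intro mult_right_mono) auto
    then show "N k * (L k)\<^sup>2 \<le> L 0 * (N k * L k)"
      by (simp add: power2_eq_square mult_ac)
  qed
  also have "\<dots> = L 0 * real m"
    using suminf_mult[OF sums_summable[OF N_L_sums]] N_L_sums by (simp add: sums_iff)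
  finally show ?thesis .
qed

lemma dof2_pos: "dof2 > 0"
  unfolding dof2_def
proof (intro suminf_pos summable_N_L_sq)
  show "0 < N k * (L k)\<^sup>2" for k using N_pos[of k] L_pos[of k] by simp
qed

lemma dof2_less: "dof2 < real m"
proof -
  have "L 0 * real m < real m" using L_less_1[of 0] m by simp
  with dof2_le show ?thesis by linarith
qed

lemma overfit_coeff_gt_1: "overfit_coeff d tau m > 1"
  using dof2_pos dof2_less by (simp add: overfit_coeff_eq)

lemma overfit_coeff_le: "overfit_coeff d tau m \<le> 1 / (1 - L 0)"
proof -
  have "real m * (1 - L 0) \<le> real m - dof2" using dof2_le by (simp add: algebra_simps)
  then show ?thesis using dof2_less L_less_1[of 0]
    by (simp add: overfit_coeff_eq field_simps)
qed

text \<open>A budget argument: by \<open>lam_ge\<close> every degree up to K has learnability at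
  least \<open>L 0 / e\<close>, these degrees carry at least S eigenfunctions, and all
  learnabilities together sum to m.\<close>

lemma L_0_le:
  "L 0 \<le> real m / ((real K + 1) / real p) ^ p * exp (tau\<^sup>2 * (real K * (real K + real d)))"
proof -
  define e where "e = exp (tau\<^sup>2 * (real K * (real K + real d)))"
  define S where "S = ((real K + 1) / real p) ^ p"
  have e: "e > 0" and S: "S > 0" using p_pos by (auto simp: e_def S_def)
  have "lam 0 / e \<le> lam K" using lam_ge[of K] by (simp only: e_def exp_minus divide_inverse)
  then have "lam 0 / e / (lam 0 + \<kappa>) \<le> lam K / (lam K + \<kappa>)"
    using lam_antimono[of 0 K] lam_pos[of K] lam_pos[of 0] kappa0_pos e by (intro frac_le) auto
  then have "L 0 / e \<le> L K" by (simp add: learnability_def field_simps)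
  then have "S * (L 0 / e) \<le> S * L K" using S by (intro mult_left_mono) auto
  also have "\<dots> \<le> (\<Sum>k\<le>K. N k) * L K"
    unfolding S_def by (intro mult_right_mono sum_N_ge L_nonneg)
  also have "\<dots> \<le> (\<Sum>k\<le>K. N k * L k)"
    unfolding sum_distrib_right by (intro sum_mono mult_left_mono L_antimono) auto
  also have "\<dots> \<le> real m" by (rule sum_N_L_le) simp
  finally show ?thesis using e S unfolding e_def[symmetric] S_def[symmetric]
    by (simp add: field_simps)
qed

lemma L_0_le_small_tau:
  assumes "tau \<le> 1"
  shows "L 0 \<le> real m * (real p * tau) ^ p * exp (1 + real d)"
proof -
  \<comment> \<open>About the largest degree at which the exponent from \<open>lam_ge\<close> stays
    bounded, here by 1 + d.\<close>
  define K where "K = nat \<lfloor>1 / tau\<rfloor>"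
  have K: "real K \<le> 1 / tau" "1 / tau \<le> real K + 1"
    using tau by (auto simp: K_def)
  have Kt: "tau * real K \<le> 1" using K(1) tau by (simp add: field_simps)
  have "tau\<^sup>2 * (real K * (real K + real d)) = (tau * real K) * (tau * real K) + tau * (tau * real K) * real d"
    by (simp add: power2_eq_square algebra_simps)
  also have "\<dots> \<le> 1 * 1 + 1 * 1 * real d"
    using Kt tau assms by (intro add_mono mult_mono) auto
  finally have e: "exp (tau\<^sup>2 * (real K * (real K + real d))) \<le> exp (1 + real d)" by simp
  have "1 / (real p * tau) \<le> (real K + 1) / real p"
    using divide_right_mono[OF K(2), of "real p"] by (simp add: mult_ac)
  then have "(1 / (real p * tau)) ^ p \<le> ((real K + 1) / real p) ^ p"
    using tau by (intro power_mono) auto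
  then have "real m / ((real K + 1) / real p) ^ p \<le> real m / (1 / (real p * tau)) ^ p"
    using tau p_pos by (intro divide_left_mono mult_pos_pos zero_less_power) auto
  also have "\<dots> = real m * (real p * tau) ^ p" by (simp add: power_one_over)
  finally show ?thesis
    using L_0_le[of K] mult_mono[OF _ e] tau by (smt (verit) exp_ge_zero mult_nonneg_nonneg of_nat_0_le_iff zero_le_power)
qed

text \<open>The degree at which the multiplicities have added up to order m. The product
  \<open>tau * rt\<close> is the bandwidth in its natural unit and separates the three
  regimes.\<close>

definition rt :: real where "rt = real m powr (1 / real p)"

lemma rt_ge_1: "rt \<ge> 1"
  unfolding rt_def using m by (intro ge_one_powr_ge_zero) auto

lemma rt_power: "rt ^ p = real m"
proof -
  have "rt ^ p = rt powr real p" using rt_ge_1 by (simp add: powr_realpow)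
  also have "\<dots> = real m" using p_pos m by (simp add: rt_def powr_powr)
  finally show ?thesis .
qed

text \<open>The factor \<open>2 * p\<close> cancels the division by p in \<open>sum_N_ge\<close> and
  leaves \<open>(2 * rt) ^ p = 2 ^ p * m\<close>.\<close>

lemma sum_N_ge_sample:
  assumes "real K \<ge> 2 * real p * rt"
  shows "2 * real m \<le> (\<Sum>k\<le>K. N k)"
proof -
  have "2 * real m \<le> 2 ^ p * real m" 
    using self_le_power[of "2::real" p] p_pos by (intro mult_right_mono) auto
  also have "\<dots> = (2 * rt) ^ p" unfolding power_mult_distrib rt_power ..
  also have "\<dots> \<le> ((real K + 1) / real p) ^ p"
    using assms p_pos rt_ge_1 by (intro power_mono) (auto simp: field_simps)
  also have "\<dots> \<le> (\<Sum>k\<le>K. N k)" by (rule sum_N_ge)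
  finally show ?thesis .
qed

text \<open>At least 2m eigenfunctions of degree at most K share a total learnability of at most m,
  so the smallest of them, \<open>L K\<close>, is at most 1/2.\<close>

lemma lam_le_kappa0:
  assumes "real K \<ge> 2 * real p * rt"
  shows "lam K \<le> \<kappa>"
proof -
  have "2 * real m * L K \<le> (\<Sum>k\<le>K. N k) * L K"
    by (intro mult_right_mono sum_N_ge_sample assms L_nonneg)
  also have "\<dots> \<le> (\<Sum>k\<le>K. N k * L k)"
    unfolding sum_distrib_right by (intro sum_mono mult_left_mono L_antimono) auto
  also have "\<dots> \<le> real m" by (rule sum_N_L_le) simp
  finally have "L K \<le> 1 / 2" using m by simp
  then show ?thesis using lam_pos[of K] kappa0_pos by (simp add: learnability_def field_simps)
qed

section \<open>Bandwidths comparable to 1 / rt\<close>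

definition K0 :: nat where "K0 = nat \<lceil>2 * real p * rt\<rceil>"

lemma K0_ge: "real K0 \<ge> 2 * real p * rt"
  unfolding K0_def using rt_ge_1 by linarith

text \<open>As \<open>rt \<ge> 1\<close>, the rounding in \<open>K0\<close> and the shift by d are
  absorbed into the constants, and the exponent in \<open>lam_ge\<close> is controlled by
  \<open>tau * rt\<close> alone.\<close>

lemma lam_K0_ge:
  assumes "tau * rt \<le> C"
  shows "lam 0 * exp (- (C\<^sup>2 * ((2 * real p + 1) * (2 * real p + 1 + real d)))) \<le> lam K0"
proof -
  have "real K0 \<le> 2 * real p * rt + 1"
    unfolding K0_def using rt_ge_1 p_pos by (simp add: ceiling_correct)
  also have "\<dots> \<le> (2 * real p + 1) * rt" using rt_ge_1 by (simp add: algebra_simps)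
  finally have K: "real K0 \<le> (2 * real p + 1) * rt" .
  have Kd: "real K0 + real d \<le> (2 * real p + 1 + real d) * rt"
  proof -
    have "real d * 1 \<le> real d * rt" using rt_ge_1 by (intro mult_left_mono) auto
    then show ?thesis using K by (simp add: algebra_simps)
  qed
  have "tau\<^sup>2 * (real K0 * (real K0 + real d))
      \<le> tau\<^sup>2 * ((2 * real p + 1) * rt * ((2 * real p + 1 + real d) * rt))"
    using rt_ge_1 by (intro mult_left_mono mult_mono K Kd) auto
  also have "\<dots> = (tau * rt)\<^sup>2 * ((2 * real p + 1) * (2 * real p + 1 + real d))"
    by (simp add: power2_eq_square)
  also have "\<dots> \<le> C\<^sup>2 * ((2 * real p + 1) * (2 * real p + 1 + real d))"
    using tau rt_ge_1 assms by (intro mult_right_mono power_mono) auto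
  finally have "lam 0 * exp (- (C\<^sup>2 * ((2 * real p + 1) * (2 * real p + 1 + real d))))
      \<le> lam 0 * exp (- (tau\<^sup>2 * (real K0 * (real K0 + real d))))"
    using lam_pos[of 0] by simp
  also note lam_ge
  finally show ?thesis .
qed

text \<open>The chain \<open>lam 0 * E \<le> lam K0 \<le> \<kappa>\<close> keeps the largest
  learnability away from 1, uniformly in m.\<close>

lemma L_0_le_bounded_tau:
  assumes "tau * rt \<le> C"
  defines "E \<equiv> exp (- (C\<^sup>2 * ((2 * real p + 1) * (2 * real p + 1 + real d))))"
  shows "L 0 \<le> 1 / (1 + E)"
proof -
  have "lam 0 * E \<le> \<kappa>"
    using lam_K0_ge[OF assms(1)] lam_le_kappa0[OF K0_ge] by (simp add: E_def)
  moreover have "E > 0" by (simp add: E_def)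
  ultimately show ?thesis using lam_pos[of 0] kappa0_pos
    by (simp add: learnability_def field_simps add_pos_pos)
qed

definition M0 :: nat where "M0 = nat \<lceil>rt\<rceil>"

lemma M0_bounds: "rt \<le> real M0" "real M0 \<le> 2 * rt" "M0 > 0"
  unfolding M0_def using rt_ge_1 by (linarith, linarith, simp)

lemma M0_power_le: "real M0 ^ p \<le> 2 ^ p * real m"
proof -
  have "real M0 ^ p \<le> (2 * rt) ^ p" using M0_bounds by (intro power_mono) auto
  then show ?thesis unfolding power_mult_distrib rt_power .
qed

text \<open>Since \<open>lam / (lam + \<kappa>) \<le> lam / \<kappa>\<close>, m times \<kappa> is at
  most the trace, the sum of \<open>N * lam\<close>. Below degree \<open>M0\<close> the trace is
  bounded by \<open>lam 0\<close> and a count of eigenfunctions, beyond it by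
  \<open>lam_tail_sum_le\<close> with j = 1; both parts are of order
  \<open>lam 0 * m\<close>.\<close>

lemma kappa0_le_bounded_tau:
  assumes "C > 0" "C \<le> tau * rt"
  defines "b \<equiv> C\<^sup>2 / 2"
  shows "\<kappa> \<le> 2 ^ p * (2 * (1 + real p) ^ (p - 1) + 2 * exp b * (1 + 1 / b) ^ p) * lam 0"
proof -
  have b: "b > 0" using assms by (simp add: b_def)
  \<comment> \<open>The first summand comes from the head, the second from the tail; the extra
    \<open>2 ^ p\<close> in the statement pays for rounding rt up to \<open>M0\<close>.\<close>
  define G where "G = 2 * (1 + real p) ^ (p - 1) + 2 * exp b * (1 + 1 / b) ^ p"
  have G: "G > 0" using b by (simp add: G_def add_pos_pos)
  have pp: "real M0 * real M0 ^ (p - 1) = real M0 ^ p"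
    using p_pos by (simp add: power_eq_if)
  have M1: "real M0 \<ge> 1" using M0_bounds(3) by simp
  have bt: "b / real M0 ^ 2 \<le> tau\<^sup>2 / 2"
  proof -
    have "C\<^sup>2 \<le> (tau * rt)\<^sup>2" using assms by (intro power_mono) auto
    also have "\<dots> \<le> (tau * real M0)\<^sup>2" using M0_bounds rt_ge_1 tau by (intro power_mono mult_left_mono) auto
    finally show ?thesis using M1 by (simp add: b_def field_simps)
  qed
  have head: "(\<Sum>k<M0. N k * lam k) \<le> lam 0 * (2 * (1 + real p) ^ (p - 1) * real M0 ^ p)"
  proof -
    have "(\<Sum>k<M0. N k * lam k) \<le> (\<Sum>k<M0. 2 * (real M0 * (1 + real p)) ^ (p - 1) * lam 0)"
    proof (intro sum_mono mult_mono lam_antimono)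
      fix k assume k: "k \<in> {..<M0}"
      have "real p * 1 \<le> real p * real M0" using M1 by (intro mult_left_mono) auto
      then have "real k + real p \<le> real M0 * (1 + real p)" using k by (simp add: algebra_simps)
      then have "(real k + real p) ^ (p - 1) \<le> (real M0 * (1 + real p)) ^ (p - 1)"
        by (intro power_mono) auto
      then show "N k \<le> 2 * (real M0 * (1 + real p)) ^ (p - 1)" using N_le_power[of k] by simp
    qed (auto simp: lam_nonneg)
    also have "\<dots> = lam 0 * (2 * (1 + real p) ^ (p - 1) * (real M0 * real M0 ^ (p - 1)))"
      by (simp add: power_mult_distrib mult_ac)
    finally show ?thesis by (simp only: pp)
  qed
  have tail: "(\<Sum>k\<in>{1 * M0..<n}. N k * lam k) \<le> lam 0 * (2 * exp b * (1 + 1 / b) ^ p * real M0 ^ p)" for n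
  proof -
    have "(\<Sum>k\<in>{1 * M0..<n}. N k * lam k)
        \<le> lam (1 * M0) * (2 * exp (b * real 1 * real 1) * (1 + real M0 / (b * real 1)) ^ p)"
      using b bt M0_bounds by (intro lam_tail_sum_le) auto
    also have "\<dots> \<le> lam 0 * (2 * exp b * ((1 + 1 / b) * real M0) ^ p)"
    proof (intro mult_mono lam_antimono power_mono)
      show "1 + real M0 / (b * real 1) \<le> (1 + 1 / b) * real M0" using M1 by (simp add: algebra_simps)
    qed (use b lam_nonneg in auto)
    finally show ?thesis by (simp add: power_mult_distrib mult_ac)
  qed
  have "(\<Sum>k<n. N k * lam k) \<le> lam 0 * (G * real M0 ^ p)" for n
  proof -
    have "(\<Sum>k<n. N k * lam k) \<le> (\<Sum>k\<in>{..<M0} \<union> {1 * M0..<n}. N k * lam k)"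
      using lam_nonneg by (intro sum_mono2) auto
    also have "\<dots> = (\<Sum>k<M0. N k * lam k) + (\<Sum>k\<in>{1 * M0..<n}. N k * lam k)"
      by (intro sum.union_disjoint) auto
    also have "\<dots> \<le> lam 0 * (G * real M0 ^ p)"
      using head tail[of n] by (simp add: G_def distrib_left distrib_right)
    finally show ?thesis .
  qed
  then have T: "(\<Sum>k. N k * lam k) \<le> lam 0 * (G * real M0 ^ p)"
    by (intro suminf_le_const summable_N_lam)
  have "real m \<le> (\<Sum>k. N k * lam k * (1 / \<kappa>))"
  proof -
    have "N k * (lam k / (lam k + \<kappa>)) \<le> N k * (lam k / \<kappa>)" for k
      using lam_pos[of k] kappa0_pos by (intro mult_left_mono divide_left_mono) auto
    then have "dof \<kappa> \<le> (\<Sum>k. N k * lam k * (1 / \<kappa>))"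
      unfolding dof_def by (intro suminf_le summable_N_learn kappa0_pos summable_mult2 summable_N_lam) auto
    then show ?thesis by (simp add: dof_kappa0)
  qed
  also have "\<dots> = (\<Sum>k. N k * lam k) * (1 / \<kappa>)" by (rule suminf_mult2[OF summable_N_lam, symmetric])
  finally have "real m * \<kappa> \<le> (\<Sum>k. N k * lam k)" using kappa0_pos by (simp add: field_simps)
  also have "\<dots> \<le> lam 0 * (G * (2 ^ p * real m))"
  proof (rule order.trans[OF T])
    show "lam 0 * (G * real M0 ^ p) \<le> lam 0 * (G * (2 ^ p * real m))"
      by (intro mult_left_mono M0_power_le lam_nonneg less_imp_le[OF G])
  qed
  finally have "real m * \<kappa> \<le> real m * (2 ^ p * G * lam 0)" by (simp add: mult_ac)
  then show ?thesis using m by (simp add: G_def)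
qed

text \<open>From \<open>lam 0 * E \<le> lam K0\<close> and \<open>\<kappa> \<le> H * lam 0\<close>
  follows \<open>L K0 \<ge> E / (E + H)\<close>. At least 2m eigenfunctions have learnability at
  least \<open>L K0\<close>, so \<open>dof2\<close> is at least a fixed fraction of m.\<close>

lemma overfit_coeff_ge_bounded_tau:
  assumes "C1 > 0" "C1 \<le> tau * rt" "tau * rt \<le> C2"
  defines "b \<equiv> C1\<^sup>2 / 2"
  defines "E \<equiv> exp (- (C2\<^sup>2 * ((2 * real p + 1) * (2 * real p + 1 + real d))))"
  defines "H \<equiv> 2 ^ p * (2 * (1 + real p) ^ (p - 1) + 2 * exp b * (1 + 1 / b) ^ p)"
  shows "overfit_coeff d tau m \<ge> 1 + 2 * (E / (E + H))\<^sup>2"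
proof -
  define \<delta> where "\<delta> = 2 * (E / (E + H))\<^sup>2"
  have E: "E > 0" by (simp add: E_def)
  have b: "b > 0" using assms(1) by (simp add: b_def)
  have H: "H > 0" using b by (simp add: H_def add_pos_pos)
  have LE: "lam 0 * E \<le> lam K0" using lam_K0_ge[OF assms(3)] by (simp add: E_def)
  have kH: "\<kappa> \<le> H * lam 0" using kappa0_le_bounded_tau[OF assms(1,2)] by (simp add: H_def b_def)
  have "E * \<kappa> \<le> E * (H * lam 0)" using kH E by simp
  also have "\<dots> \<le> H * lam K0" using mult_left_mono[OF LE, of H] H by (simp add: mult_ac)
  finally have "E / (E + H) \<le> L K0"
    using E H lam_pos[of K0] kappa0_pos by (simp add: learnability_def field_simps add_pos_pos)
  then have sq: "(E / (E + H))\<^sup>2 \<le> (L K0)\<^sup>2" using E H by (intro power_mono) auto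
  have "\<delta> * real m = 2 * real m * (E / (E + H))\<^sup>2" by (simp add: \<delta>_def)
  also have "\<dots> \<le> (\<Sum>k\<le>K0. N k) * (L K0)\<^sup>2"
    using sum_N_ge_sample[OF K0_ge] sq by (intro mult_mono) auto
  also have "\<dots> \<le> (\<Sum>k\<le>K0. N k * (L k)\<^sup>2)"
    unfolding sum_distrib_right
    by (intro sum_mono mult_left_mono power_mono L_antimono L_nonneg) auto
  also have "\<dots> \<le> dof2"
    unfolding dof2_def by (intro sum_le_suminf summable_N_L_sq) auto
  finally have dm: "\<delta> * real m \<le> dof2" .
  \<comment> \<open>The inequality \<open>1 / (1 - \<delta>) \<ge> 1 + \<delta>\<close> in
    division-free form.\<close>
  have "(1 + \<delta>) * (real m - dof2) \<le> (1 + \<delta>) * (real m - \<delta> * real m)"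
    using dm by (intro mult_left_mono) (auto simp: \<delta>_def)
  also have "\<dots> = real m - \<delta>\<^sup>2 * real m" by (simp add: algebra_simps power2_eq_square)
  also have "\<dots> \<le> real m" by simp
  finally show ?thesis using dof2_less unfolding overfit_coeff_eq \<delta>_def[symmetric]
    by (simp add: field_simps)
qed

text \<open>Halving of the eigenvalues over B degrees dominates L(1 - L) by a difference that telescopes
  when summed over k.\<close>

lemma L_variance_le:
  assumes B: "real B * real B * tau\<^sup>2 / 2 \<ge> 1" and k: "k \<ge> 2 * B"
  shows "L k * (1 - L k) \<le> L (k - B) - L (k + B)"
proof -
  \<comment> \<open>Every degree from B on loses at least the factor 1 + s, and
    \<open>B * s \<ge> 1\<close> by hypothesis, so by Bernoulli B such degrees at least halve the
    eigenvalue.\<close>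
  define s where "s = real B * tau\<^sup>2 / 2"
  have s: "s \<ge> 0" by (simp add: s_def)
  have "2 \<le> 1 + real B * s" using B by (simp add: s_def mult_ac)
  also have "\<dots> \<le> (1 + s) ^ B" using Bernoulli_inequality[of s B] s by simp
  finally have 2: "2 \<le> (1 + s) ^ B" .
  have dec: "2 * lam (i + B) \<le> lam i" if "i \<ge> B" for i
  proof -
    have "s \<le> real i * tau\<^sup>2 / 2" unfolding s_def using that by (intro divide_right_mono mult_right_mono) auto
    from lam_decay[OF s this, of B] mult_left_mono[OF 2, of "lam (i + B)"] lam_nonneg
    show ?thesis by (smt (verit) mult.commute)
  qed
  define a c e where "a = lam (k - B)" and "c = lam k" and "e = lam (k + B)"
  have ac: "2 * c \<le> a" using dec[of "k - B"] k by (simp add: a_def c_def)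
  have ce: "2 * e \<le> c" using dec[of k] k by (simp add: c_def e_def)
  have pos: "a > 0" "c > 0" "e > 0" "\<kappa> > 0" using lam_pos kappa0_pos by (auto simp: a_def c_def e_def)
  define z where "z = \<kappa>"
  have z: "z > 0" using pos by (simp add: z_def)
  \<comment> \<open>As \<open>a \<ge> 2 * c\<close> and \<open>e \<le> c / 2\<close>, the outer
    learnabilities differ by at least \<open>3 * c * z / ((2 * c + z) * (c + 2 * z))\<close>. The
    denominator is at most \<open>3 * (c + z)\<^sup>2\<close>, which gives the variance term
    \<open>c * z / (c + z)\<^sup>2\<close>.\<close>
  have 1: "2 * c / (2 * c + z) \<le> a / (a + z)" using ac pos z by (simp add: field_simps)
  have 3: "e / (e + z) \<le> c / (c + 2 * z)" using ce pos z by (simp add: field_simps)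
  have 4: "c / (c + z) * (1 - c / (c + z)) = c * z / (c + z)\<^sup>2"
    using pos z by (simp add: field_simps power2_eq_square)
  have 5: "2 * c / (2 * c + z) - c / (c + 2 * z) = 3 * c * z / ((2 * c + z) * (c + 2 * z))"
    using pos z by (simp add: divide_simps) (simp add: algebra_simps)
  have "(2 * c + z) * (c + 2 * z) = 3 * (c + z)\<^sup>2 - c * c - c * z - z * z"
    by (simp add: algebra_simps power2_eq_square)
  also have "\<dots> \<le> 3 * (c + z)\<^sup>2"
    using mult_pos_pos[OF pos(2) z] mult_pos_pos[OF pos(2) pos(2)] mult_pos_pos[OF z z] by linarith
  finally have "3 * c * z / (3 * (c + z)\<^sup>2) \<le> 3 * c * z / ((2 * c + z) * (c + 2 * z))"
    using pos z by (intro divide_left_mono) auto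
  then have "c * z / (c + z)\<^sup>2 \<le> 3 * c * z / ((2 * c + z) * (c + 2 * z))" by simp
  then show ?thesis using 1 3 4 5
    by (simp add: learnability_def flip: a_def c_def e_def z_def)
qed

text \<open>Without multiplicities the terms L(1 - L) sum to at most 4B whatever T is: the first 2B
  are at most 1 each, and the rest telescope. The multiplicities then enter through a uniform bound
  below T.\<close>

lemma sum_L_variance_le:
  assumes B: "real B * real B * tau\<^sup>2 / 2 \<ge> 1"
  shows "(\<Sum>k<T. N k * (L k * (1 - L k))) \<le> 8 * real B * (real T + real p) ^ (p - 1)"
proof -
  define V where "V k = L k * (1 - L k)" for k
  have V0: "V k \<ge> 0" and V1: "V k \<le> 1" for k
    using L_pos[of k] L_less_1[of k] mult_le_one[of "L k" "1 - L k"] by (auto simp: V_def)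
  \<comment> \<open>Extending the range to \<open>2 * B + T\<close> makes the shifted remainder run
    over exactly k < T.\<close>
  have "(\<Sum>k<T. V k) \<le> (\<Sum>k\<in>{..<2 * B} \<union> {2 * B..<2 * B + T}. V k)"
    using V0 by (intro sum_mono2) auto
  also have "\<dots> = (\<Sum>k<2 * B. V k) + (\<Sum>k\<in>{2 * B..<2 * B + T}. V k)"
    by (intro sum.union_disjoint) auto
  also have "(\<Sum>k<2 * B. V k) \<le> (\<Sum>k<2 * B. 1)" by (intro sum_mono V1)
  also have "(\<Sum>k\<in>{2 * B..<2 * B + T}. V k) = (\<Sum>k<T. V (k + 2 * B))"
    by (simp add: sum.shift_bounds_nat_ivl[of V 0 "2 * B" T, simplified] add.commute lessThan_atLeast0)
  also have "\<dots> \<le> (\<Sum>k<T. L (B + k) - L (B + (k + 2 * B)))"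
  proof (intro sum_mono)
    fix k
    have "V (k + 2 * B) \<le> L (k + 2 * B - B) - L (k + 2 * B + B)"
      unfolding V_def by (intro L_variance_le B) auto
    also have "k + 2 * B - B = B + k" by simp
    also have "k + 2 * B + B = B + (k + 2 * B)" by simp
    finally show "V (k + 2 * B) \<le> L (B + k) - L (B + (k + 2 * B))" .
  qed
  also have "\<dots> \<le> real (2 * B)"
    using L_nonneg L_less_1 less_imp_le by (intro sum_shift_diff_le[of "\<lambda>k. L (B + k)"]) auto
  finally have VT: "(\<Sum>k<T. V k) \<le> 4 * real B" by simp
  have "(\<Sum>k<T. N k * V k) \<le> (\<Sum>k<T. 2 * (real T + real p) ^ (p - 1) * V k)"
  proof (intro sum_mono mult_right_mono V0)
    fix k assume "k \<in> {..<T}"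
    then have "(real k + real p) ^ (p - 1) \<le> (real T + real p) ^ (p - 1)" by (intro power_mono) auto
    then show "N k \<le> 2 * (real T + real p) ^ (p - 1)" using N_le_power[of k] by simp
  qed
  also have "\<dots> = 2 * (real T + real p) ^ (p - 1) * (\<Sum>k<T. V k)" by (simp add: sum_distrib_left)
  also have "\<dots> \<le> 2 * (real T + real p) ^ (p - 1) * (4 * real B)"
    by (intro mult_left_mono VT) auto
  finally show ?thesis by (simp add: V_def mult_ac)
qed

text \<open>The left side is the series of \<open>N * (L * (1 - L))\<close>. Below T it is bounded
  by \<open>sum_L_variance_le\<close> with B about \<open>2 / tau\<close>, beyond T by
  \<open>L \<le> lam / \<kappa>\<close> and the smallness of \<open>lam T\<close>.\<close>

lemma dof_minus_dof2_le:
  assumes W: "tau * rt \<ge> 2"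
  defines "Q \<equiv> 2 * exp ((2 * real p + 1)\<^sup>2) * 4 ^ p + 16 * (3 * real p + 1) ^ (p - 1) * 2 ^ p"
  shows "real m - dof2 \<le> real m * (Q * (1 / (tau * rt) + 1 / rt))"
proof -
  define w where "w = tau * rt"
  \<comment> \<open>At degree \<open>2 * p * M0\<close> the eigenvalue is already at most \<kappa>;
    the additional \<open>M0\<close> degrees gain the factor w in \<open>lamT\<close>.\<close>
  define j where "j = 2 * p + 1"
  define B where "B = nat \<lceil>2 / tau\<rceil>"
  define T where "T = j * M0"
  have rj: "real j = 2 * real p + 1"
    by (simp only: j_def of_nat_mult of_nat_add of_nat_numeral of_nat_1)
  have M1: "real M0 \<ge> 1" using M0_bounds(3) by simp
  have w: "w \<ge> 2" using W by (simp add: w_def)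
  have wM: "w \<le> tau * real M0" using M0_bounds tau by (simp add: w_def)
  have B: "2 / tau \<le> real B" "real B \<le> 2 / tau + 1"
    using tau by (auto simp: B_def)
  have "1 \<le> (2 / tau) * (2 / tau) * tau\<^sup>2 / 2" using tau by (simp add: power2_eq_square)
  also have "\<dots> \<le> real B * real B * tau\<^sup>2 / 2"
    using B tau by (intro divide_right_mono mult_right_mono mult_mono) auto
  finally have Bt: "real B * real B * tau\<^sup>2 / 2 \<ge> 1" .
  have pp: "real M0 * real M0 ^ (p - 1) = real M0 ^ p"
    using p_pos by (simp add: power_eq_if)
  have head: "(\<Sum>k<T. N k * (L k * (1 - L k)))
      \<le> real m * (16 * (3 * real p + 1) ^ (p - 1) * 2 ^ p * (1 / w + 1 / rt))"
  proof -
    have "real T = (2 * real p + 1) * real M0" by (simp only: T_def of_nat_mult rj)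
    then have "real T + real p \<le> (3 * real p + 1) * real M0"
      using mult_left_mono[OF M1, of "real p"] by (simp add: algebra_simps)
    then have TT: "(real T + real p) ^ (p - 1) \<le> ((3 * real p + 1) * real M0) ^ (p - 1)"
      by (intro power_mono) auto
    have "2 / tau = 2 * rt / w" using rt_ge_1 tau by (simp add: w_def)
    also have "\<dots> \<le> 2 * real M0 / w" using M0_bounds w by (intro divide_right_mono) auto
    \<comment> \<open>The 1 from rounding B up is absorbed by \<open>2 * M0 / rt\<close>; this is
      the origin of the \<open>1 / rt\<close> in the bound.\<close>
    finally have "real B \<le> 2 * real M0 / w + 2 * real M0 / rt"
      using B(2) M0_bounds rt_ge_1 by (smt (verit) le_divide_eq_1_pos divide_right_mono)
    then have BM: "real B \<le> 2 * real M0 * (1 / w + 1 / rt)" by (simp add: algebra_simps)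
    have "(\<Sum>k<T. N k * (L k * (1 - L k))) \<le> 8 * real B * (real T + real p) ^ (p - 1)"
      by (rule sum_L_variance_le[OF Bt])
    also have "\<dots> \<le> 8 * (2 * real M0 * (1 / w + 1 / rt)) * ((3 * real p + 1) * real M0) ^ (p - 1)"
      using BM TT w rt_ge_1 by (intro mult_mono) auto
    also have "\<dots> = 16 * (3 * real p + 1) ^ (p - 1) * (1 / w + 1 / rt) * (real M0 * real M0 ^ (p - 1))"
      by (simp add: power_mult_distrib mult_ac)
    also have "\<dots> \<le> 16 * (3 * real p + 1) ^ (p - 1) * (1 / w + 1 / rt) * (2 ^ p * real m)"
      unfolding pp using M0_power_le w rt_ge_1 by (intro mult_left_mono) auto
    finally show ?thesis by (simp add: mult_ac)
  qed
  have lamT: "lam T \<le> \<kappa> / w"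
  proof -
    define s where "s = real (2 * p * M0) * tau\<^sup>2 / 2"
    have s: "s \<ge> 0" by (simp add: s_def)
    \<comment> \<open>The chain \<open>w \<le> w\<^sup>2 \<le> M0 * s\<close> lets Bernoulli's
      inequality shrink the eigenvalue by a factor w over \<open>M0\<close> degrees.\<close>
    have "w * 1 \<le> w * w" using w by (intro mult_left_mono) auto
    also have "\<dots> \<le> (tau * real M0) * (tau * real M0)" using wM w by (intro mult_mono) auto
    also have "\<dots> \<le> real p * ((tau * real M0) * (tau * real M0))" using p_pos by (simp add: mult_le_cancel_right1)
    also have "\<dots> = real M0 * s" by (simp add: s_def power2_eq_square)
    also have "\<dots> \<le> (1 + s) ^ M0" using Bernoulli_inequality[of s M0] s by simp
    finally have ws: "w \<le> (1 + s) ^ M0" by simp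
    have "T = 2 * p * M0 + M0" by (simp add: T_def j_def)
    then have "lam T * (1 + s) ^ M0 \<le> lam (2 * p * M0)"
      using lam_decay[OF s, of "2 * p * M0" M0] by (simp add: s_def)
    also have "\<dots> \<le> \<kappa>" using M0_bounds by (intro lam_le_kappa0) (simp add: mult_left_mono)
    finally have "lam T * w \<le> \<kappa>" using mult_left_mono[OF ws, of "lam T"] lam_nonneg[of T] by linarith
    then show ?thesis using w by (simp add: field_simps)
  qed
  have tail: "(\<Sum>k\<in>{T..<n}. N k * (L k * (1 - L k)))
      \<le> real m * (2 * exp ((2 * real p + 1)\<^sup>2) * 4 ^ p * (1 / w))" for n
  proof -
    have "(\<Sum>k\<in>{T..<n}. N k * (L k * (1 - L k))) \<le> (\<Sum>k\<in>{T..<n}. N k * lam k / \<kappa>)"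
    proof (intro sum_mono)
      fix k
      have "L k * (1 - L k) \<le> L k * 1" using L_pos[of k] by (intro mult_left_mono) auto
      also have "\<dots> \<le> lam k / \<kappa>" using lam_pos[of k] kappa0_pos
        by (simp add: learnability_def divide_left_mono)
      finally show "N k * (L k * (1 - L k)) \<le> N k * lam k / \<kappa>"
        using mult_left_mono[of "L k * (1 - L k)" "lam k / \<kappa>" "N k"] by simp
    qed
    also have "\<dots> = (\<Sum>k\<in>{j * M0..<n}. N k * lam k) / \<kappa>" by (simp add: sum_divide_distrib T_def)
    \<comment> \<open>The tail bound with b = 1, admissible because
      \<open>tau * M0 \<ge> 2\<close>.\<close>
    also have "\<dots> \<le> lam (j * M0) * (2 * exp (1 * real j * real j) * (1 + real M0 / (1 * real j)) ^ p) / \<kappa>"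
    proof (intro divide_right_mono lam_tail_sum_le)
      have "2 * 2 \<le> (tau * real M0) * (tau * real M0)" using wM w by (intro mult_mono) auto
      then show "1 / (real M0)\<^sup>2 \<le> tau\<^sup>2 / 2" using M1 by (simp add: field_simps power2_eq_square)
    qed (use M0_bounds kappa0_pos in \<open>auto simp: j_def\<close>)
    also have "\<dots> \<le> \<kappa> / w * (2 * exp ((2 * real p + 1)\<^sup>2) * (2 ^ p * (2 ^ p * real m))) / \<kappa>"
    proof (intro divide_right_mono mult_mono)
      show "lam (j * M0) \<le> \<kappa> / w" using lamT by (simp add: T_def)
      have "real M0 / (1 * real j) \<le> real M0" by (simp add: j_def field_simps)
      then have "(1 + real M0 / (1 * real j)) ^ p \<le> (2 * real M0) ^ p" using M1 by (intro power_mono) auto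
      also have "\<dots> \<le> 2 ^ p * (2 ^ p * real m)" using M0_power_le by (simp add: power_mult_distrib)
      finally show "(1 + real M0 / (1 * real j)) ^ p \<le> 2 ^ p * (2 ^ p * real m)" .
      show "exp (1 * real j * real j) \<le> exp ((2 * real p + 1)\<^sup>2)" by (simp only: rj power2_eq_square mult_1 order_refl)
    qed (use kappa0_pos w in auto)
    also have "\<dots> = real m * (2 * exp ((2 * real p + 1)\<^sup>2) * (2 ^ p * 2 ^ p) * (1 / w))"
      using kappa0_pos by (simp add: field_simps)
    also have "2 ^ p * 2 ^ p = (4 :: real) ^ p" by (simp flip: power_mult_distrib)
    finally show ?thesis .
  qed
  have "(\<lambda>k. N k * L k - N k * (L k)\<^sup>2) sums (real m - dof2)"
    unfolding dof2_def by (intro sums_diff N_L_sums summable_sums summable_N_L_sq)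
  then have sums: "(\<lambda>k. N k * (L k * (1 - L k))) sums (real m - dof2)"
    by (simp add: algebra_simps power2_eq_square)
  have V0: "N k * (L k * (1 - L k)) \<ge> 0" for k using L_pos[of k] L_less_1[of k] by simp
  have "(\<Sum>k<n. N k * (L k * (1 - L k))) \<le> real m * (Q * (1 / w + 1 / rt))" for n
  proof -
    have "(\<Sum>k<n. N k * (L k * (1 - L k))) \<le> (\<Sum>k\<in>{..<T} \<union> {T..<n}. N k * (L k * (1 - L k)))"
      using V0 by (intro sum_mono2) auto
    also have "\<dots> = (\<Sum>k<T. N k * (L k * (1 - L k))) + (\<Sum>k\<in>{T..<n}. N k * (L k * (1 - L k)))"
      by (intro sum.union_disjoint) auto
    also have "\<dots> \<le> real m * (16 * (3 * real p + 1) ^ (p - 1) * 2 ^ p * (1 / w + 1 / rt))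
        + real m * (2 * exp ((2 * real p + 1)\<^sup>2) * 4 ^ p * (1 / w + 1 / rt))"
    proof (intro add_mono head order.trans[OF tail] mult_left_mono)
      show "1 / w \<le> 1 / w + 1 / rt" using rt_ge_1 by simp
    qed auto
    also have "\<dots> = real m * (Q * (1 / w + 1 / rt))" by (simp add: Q_def algebra_simps)
    finally show ?thesis .
  qed
  then have "suminf (\<lambda>k. N k * (L k * (1 - L k))) \<le> real m * (Q * (1 / w + 1 / rt))"
    using sums by (intro suminf_le_const) (auto simp: sums_iff)
  then show ?thesis using sums by (simp add: sums_iff w_def)
qed

text \<open>\<open>rt \<ge> 1\<close> turns the hypothesis into \<open>tau \<le> 1\<close>, and
  \<open>m * tau ^ p = (tau * rt) ^ p\<close>.\<close>

lemma L_0_le_scaled: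
  assumes "tau * rt \<le> 1"
  shows "L 0 \<le> real p ^ p * exp (1 + real d) * (tau * rt) ^ p"
proof -
  have "tau * 1 \<le> tau * rt" using tau rt_ge_1 by (intro mult_left_mono) auto
  then have "L 0 \<le> real m * (real p * tau) ^ p * exp (1 + real d)"
    using assms by (intro L_0_le_small_tau) linarith
  also have "\<dots> = real p ^ p * exp (1 + real d) * (tau * rt) ^ p"
    unfolding power_mult_distrib rt_power by (simp only: mult_ac)
  finally show ?thesis .
qed

section \<open>Two-sided bounds on the predicted risk\<close>

lemma pred_risk_bounds:
  assumes beta: "(\<lambda>(k, j). (beta k j)\<^sup>2) summable_on harm_idx d" and "sigma2 > 0"
  shows "overfit_coeff d tau m * ((1 - L 0)\<^sup>2 * fnorm_sq d beta + sigma2) \<le> pred_risk d tau m beta sigma2"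
    and "pred_risk d tau m beta sigma2 \<le> overfit_coeff d tau m * (fnorm_sq d beta + sigma2)"
proof -
  define f where "f = (\<lambda>(k, j). (beta k j)\<^sup>2)"
  define g where "g = (\<lambda>(k, j). (1 - L k)\<^sup>2 * (beta k j)\<^sup>2)"
  \<comment> \<open>Every bias weight lies between \<open>(1 - L 0)\<^sup>2\<close> and 1, as
    \<open>L 0\<close> is the largest learnability.\<close>
  have le1: "(1 - L k)\<^sup>2 \<le> 1" for k
    using L_pos[of k] L_less_1[of k] by (intro power_le_one) auto
  have ge: "(1 - L 0)\<^sup>2 \<le> (1 - L k)\<^sup>2" for k
    using L_antimono[of 0 k] L_less_1[of 0] by (intro power_mono) auto
  have f: "f summable_on harm_idx d" using beta by (simp add: f_def)
  have gf: "g x \<le> f x" and fg: "(1 - L 0)\<^sup>2 * f x \<le> g x" and g0: "0 \<le> g x" for x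
    using mult_right_mono[OF le1[of "fst x"], of "(beta (fst x) (snd x))\<^sup>2"]
      mult_right_mono[OF ge[of "fst x"], of "(beta (fst x) (snd x))\<^sup>2"]
    by (auto simp: f_def g_def split_beta)
  have g: "g summable_on harm_idx d"
    by (rule summable_on_comparison_test[OF f]) (auto simp: gf g0)
  have 1: "infsum g (harm_idx d) \<le> fnorm_sq d beta"
    unfolding fnorm_sq_def f_def[symmetric] by (intro infsum_mono f g gf)
  have "(1 - L 0)\<^sup>2 * fnorm_sq d beta = infsum (\<lambda>x. (1 - L 0)\<^sup>2 * f x) (harm_idx d)"
    unfolding fnorm_sq_def f_def[symmetric] by (intro infsum_cmult_right[symmetric] f)
  also have "\<dots> \<le> infsum g (harm_idx d)"
    by (intro infsum_mono g summable_on_cmult_right f fg)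
  finally have 2: "(1 - L 0)\<^sup>2 * fnorm_sq d beta \<le> infsum g (harm_idx d)" .
  show "overfit_coeff d tau m * ((1 - L 0)\<^sup>2 * fnorm_sq d beta + sigma2) \<le> pred_risk d tau m beta sigma2"
    and "pred_risk d tau m beta sigma2 \<le> overfit_coeff d tau m * (fnorm_sq d beta + sigma2)"
    using 1 2 overfit_coeff_gt_1
    by (auto simp: pred_risk_def mult_left_mono simp flip: g_def)
qed

text \<open>Strictness comes from an overfitting coefficient above 1 acting on positive noise;
  \<open>(1 - L 0)\<^sup>2 \<ge> 1 - 2 * L 0\<close> linearises the bias.\<close>

lemma pred_risk_gt:
  assumes "(\<lambda>(k, j). (beta k j)\<^sup>2) summable_on harm_idx d" "sigma2 > 0"
  shows "sigma2 + (1 - 2 * L 0) * fnorm_sq d beta < pred_risk d tau m beta sigma2"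
proof -
  define F where "F = fnorm_sq d beta"
  have F: "F \<ge> 0" by (simp add: F_def fnorm_sq_nonneg)
  have "1 - 2 * L 0 \<le> (1 - L 0)\<^sup>2" by (simp add: power2_eq_square algebra_simps)
  then have "sigma2 + (1 - 2 * L 0) * F \<le> 1 * ((1 - L 0)\<^sup>2 * F + sigma2)"
    using mult_right_mono[OF _ F] by simp
  also have "\<dots> < overfit_coeff d tau m * ((1 - L 0)\<^sup>2 * F + sigma2)"
    using F assms(2) overfit_coeff_gt_1 by (intro mult_strict_right_mono add_nonneg_pos) auto
  also have "\<dots> \<le> pred_risk d tau m beta sigma2" unfolding F_def by (intro pred_risk_bounds assms)
  finally show ?thesis by (simp add: F_def)
qed

lemma pred_risk_le:
  assumes "(\<lambda>(k, j). (beta k j)\<^sup>2) summable_on harm_idx d" "sigma2 > 0"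
  shows "pred_risk d tau m beta sigma2 \<le> (fnorm_sq d beta + sigma2) / (1 - L 0)"
proof -
  have "pred_risk d tau m beta sigma2 \<le> overfit_coeff d tau m * (fnorm_sq d beta + sigma2)"
    by (intro pred_risk_bounds assms)
  also have "\<dots> \<le> 1 / (1 - L 0) * (fnorm_sq d beta + sigma2)"
    using assms(2) fnorm_sq_nonneg[of d beta] by (intro mult_right_mono overfit_coeff_le) auto
  finally show ?thesis by simp
qed

end

section \<open>Asymptotic regimes\<close>

locale gauss_sequence =
  fixes d :: nat and beta :: "nat \<Rightarrow> nat \<Rightarrow> real" and sigma2 :: real and tau :: "nat \<Rightarrow> real"
  assumes d: "d \<ge> 2" and adm: "admissible d beta sigma2 tau"
begin

abbreviation scale :: "nat \<Rightarrow> real" where "scale m \<equiv> real m powr (- 1 / (real d - 1))"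
abbreviation risk :: "nat \<Rightarrow> real" where "risk m \<equiv> pred_risk d (tau m) m beta sigma2"

lemma beta: "(\<lambda>(k, j). (beta k j)\<^sup>2) summable_on harm_idx d"
  and sigma2: "sigma2 > 0" and tau: "tau m > 0"
  using adm by (auto simp: admissible_def)

lemma sample: "m > 0 \<Longrightarrow> gauss_sample d (tau m) m"
  by standard (use d tau in auto)

lemma scale_pos: "m > 0 \<Longrightarrow> scale m > 0" by simp

lemma rt_eq: "m > 0 \<Longrightarrow> gauss_sample.rt d m = 1 / scale m"
  using d sample[of m] by (simp add: gauss_sample.rt_def of_nat_diff powr_minus field_simps)

lemma scaled_eq: "m > 0 \<Longrightarrow> tau m * gauss_sample.rt d m = tau m / scale m"
  by (simp add: rt_eq)

lemma scale_tendsto: "scale \<longlonglongrightarrow> 0"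
proof -
  have "- 1 / (real d - 1) < 0" using d by simp
  then show ?thesis by (intro tendsto_neg_powr filterlim_real_sequentially) auto
qed

lemma ev_pos: "\<forall>\<^sub>F m in sequentially. m > 0"
  by (rule eventually_gt_at_top)

text \<open>\<open>L 0\<close> tends to 0, so \<open>pred_risk_gt\<close> and
  \<open>pred_risk_le\<close> squeeze the risk between two sequences tending to the null
  risk.\<close>

lemma small_tau_tendsto:
  assumes "tau \<in> o(scale)"
  shows "risk \<longlonglongrightarrow> null_risk d beta sigma2"
proof -
  define F where "F = fnorm_sq d beta"
  define A where "A = real (d - 1) ^ (d - 1) * exp (1 + real d)"
  define l where "l m = learnability d (tau m) m 0" for m
  have w: "(\<lambda>m. tau m / scale m) \<longlonglongrightarrow> 0" using assms by (rule smalloD_tendsto)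
  have "\<forall>\<^sub>F m in sequentially. tau m / scale m < 1"
    using order_tendstoD(2)[OF w, of 1] by simp
  with ev_pos have ev: "\<forall>\<^sub>F m in sequentially. m > 0 \<and> tau m / scale m \<le> 1"
    by eventually_elim auto
  have "l \<longlonglongrightarrow> 0"
  proof (rule tendsto_sandwich[where f = "\<lambda>_. 0"])
    show "\<forall>\<^sub>F m in sequentially. l m \<le> A * (tau m / scale m) ^ (d - 1)" using ev
    proof eventually_elim
      case (elim m)
      then show ?case using gauss_sample.L_0_le_scaled[OF sample[of m]]
        by (simp add: scaled_eq A_def l_def)
    qed
    show "\<forall>\<^sub>F m in sequentially. 0 \<le> l m" using ev
    proof eventually_elim
      case (elim m)
      then show ?case using gauss_sample.L_nonneg[OF sample[of m], of 0] by (simp add: l_def)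
    qed
    have "(\<lambda>m. A * (tau m / scale m) ^ (d - 1)) \<longlonglongrightarrow> A * 0 ^ (d - 1)"
      by (intro tendsto_intros w)
    also have "A * 0 ^ (d - 1) = 0" using d by simp
    finally show "(\<lambda>m. A * (tau m / scale m) ^ (d - 1)) \<longlonglongrightarrow> 0" .
  qed simp
  then have up: "(\<lambda>m. (F + sigma2) / (1 - l m)) \<longlonglongrightarrow> (F + sigma2) / (1 - 0)"
    and lo: "(\<lambda>m. sigma2 + (1 - 2 * l m) * F) \<longlonglongrightarrow> sigma2 + (1 - 2 * 0) * F"
    by (auto intro!: tendsto_eq_intros)
  have n: "(F + sigma2) / (1 - 0) = null_risk d beta sigma2" "sigma2 + (1 - 2 * 0) * F = null_risk d beta sigma2"
    by (simp_all add: null_risk_def F_def)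
  show ?thesis
  proof (rule tendsto_sandwich[OF _ _ lo[unfolded n] up[unfolded n]])
    show "\<forall>\<^sub>F m in sequentially. sigma2 + (1 - 2 * l m) * F \<le> risk m" using ev_pos
    proof eventually_elim
      case (elim m)
      then show ?case using gauss_sample.pred_risk_gt[OF sample beta sigma2, of m]
        by (simp add: F_def l_def)
    qed
    show "\<forall>\<^sub>F m in sequentially. risk m \<le> (F + sigma2) / (1 - l m)" using ev_pos
    proof eventually_elim
      case (elim m)
      then show ?case using gauss_sample.pred_risk_le[OF sample beta sigma2, of m]
        by (simp add: F_def l_def)
    qed
  qed
qed

lemma small_tau_rate:
  assumes t: "t \<longlonglongrightarrow> 0" and le: "\<forall>m\<ge>1. tau m \<le> scale m * t m"
  shows "\<exists>m0. \<forall>m>m0. risk m >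
    sigma2 + (1 - 2 * (real (d - 1) ^ (d - 1) * exp (1 + real d)) * t m powr ((real d - 1) / 2)) * fnorm_sq d beta"
proof -
  define A where "A = real (d - 1) ^ (d - 1) * exp (1 + real d)"
  have A: "A \<ge> 0" by (simp add: A_def)
  obtain m0 where m0: "\<And>m. m \<ge> m0 \<Longrightarrow> t m < 1"
    using order_tendstoD(2)[OF t, of 1] by (auto simp: eventually_sequentially)
  have "risk m > sigma2 + (1 - 2 * A * t m powr ((real d - 1) / 2)) * fnorm_sq d beta" if mgt: "m > m0" for m
  proof -
    interpret gauss_sample d "tau m" m by (rule sample) (use mgt in simp)
    have sc: "scale m > 0" using mgt by (intro scale_pos) simp
    have lem: "tau m \<le> scale m * t m" using le mgt by auto
    have w: "tau m * rt \<le> t m"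
      using lem sc mgt by (subst scaled_eq) (simp_all add: pos_divide_le_eq mult.commute)
    have w0: "tau m * rt > 0" using tau rt_ge_1 by simp
    \<comment> \<open>Positivity of \<open>t m\<close> is forced by that of \<open>tau m\<close>; it
      makes \<open>powr\<close> agree with the ordinary power below.\<close>
    have t1: "0 < t m" "t m \<le> 1" using w w0 m0[of m] mgt by auto
    have "L 0 \<le> A * (tau m * rt) ^ (d - 1)"
      using L_0_le_scaled w t1 by (simp add: A_def)
    also have "\<dots> \<le> A * t m ^ (d - 1)" using w w0 A by (intro mult_left_mono power_mono) auto
    also have "t m ^ (d - 1) = t m powr (real d - 1)"
      using t1 d by (simp add: of_nat_diff flip: powr_realpow)
    \<comment> \<open>The argument yields exponent d - 1; since \<open>0 < t m \<le> 1\<close>,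
      halving the exponent only weakens the bound.\<close>
    also have "A * t m powr (real d - 1) \<le> A * t m powr ((real d - 1) / 2)"
      using t1 d A by (intro mult_left_mono powr_mono') auto
    finally have "1 - 2 * A * t m powr ((real d - 1) / 2) \<le> 1 - 2 * L 0" by simp
    from mult_right_mono[OF this fnorm_sq_nonneg] pred_risk_gt[OF beta sigma2]
    show ?thesis by (smt (verit))
  qed
  then show ?thesis by (auto simp: A_def)
qed

text \<open>The noise alone suffices: the risk is at least \<open>sigma2\<close> times the
  overfitting coefficient, which is at least \<open>inverse (q m)\<close>. Here q tends to 0 because
  w diverges and \<open>scale\<close>, the inverse of rt, vanishes.\<close>

lemma large_tau_tendsto:
  assumes "tau \<in> \<omega>(scale)"
  shows "filterlim risk at_top sequentially"
proof -
  define Q where "Q = 2 * exp ((2 * real (d - 1) + 1)\<^sup>2) * 4 ^ (d - 1)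
      + 16 * (3 * real (d - 1) + 1) ^ (d - 1 - 1) * 2 ^ (d - 1)"
  have Q: "Q > 0" by (simp add: Q_def add_pos_nonneg)
  define w where "w m = tau m / scale m" for m
  have "\<forall>\<^sub>F m in sequentially. scale m \<noteq> 0" using ev_pos by eventually_elim simp
  then have "filterlim (\<lambda>m. norm (w m)) at_top sequentially"
    unfolding w_def using smallomegaD_filterlim_at_top_norm[OF assms] by blast
  moreover have "norm (w m) = w m" for m
    using tau[of m] by (simp add: w_def less_imp_le)
  ultimately have w: "filterlim w at_top sequentially" by simp
  have ev: "\<forall>\<^sub>F m in sequentially. m > 0 \<and> w m \<ge> 2"
    using ev_pos w[unfolded filterlim_at_top, rule_format, of 2] by eventually_elim auto
  define q where "q m = Q * (1 / w m + scale m)" for m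
  have "(\<lambda>m. inverse (w m)) \<longlonglongrightarrow> 0" by (rule tendsto_inverse_0_at_top[OF w])
  then have "q \<longlonglongrightarrow> Q * (0 + 0)"
    unfolding q_def by (intro tendsto_intros scale_tendsto) (simp add: inverse_eq_divide)
  then have q0: "q \<longlonglongrightarrow> 0" by simp
  have "filterlim (\<lambda>m. inverse (q m)) at_top sequentially"
  proof (rule filterlim_inverse_at_top[OF q0])
    show "\<forall>\<^sub>F m in sequentially. 0 < q m" using ev
    proof eventually_elim
      case (elim m)
      then show ?case using Q by (auto simp: q_def intro!: mult_pos_pos add_pos_pos)
    qed
  qed
  then have lim: "filterlim (\<lambda>m. sigma2 * inverse (q m)) at_top sequentially"
    using sigma2 by (intro filterlim_tendsto_pos_mult_at_top[OF tendsto_const])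
  show ?thesis
  proof (rule filterlim_at_top_mono[OF lim])
    show "\<forall>\<^sub>F m in sequentially. sigma2 * inverse (q m) \<le> risk m" using ev
    proof eventually_elim
      case (elim m)
      then interpret gauss_sample d "tau m" m by (intro sample) simp
      have qm: "q m > 0" using elim Q by (auto simp: q_def intro!: mult_pos_pos add_pos_pos)
      have rts: "1 / rt = scale m" using elim by (simp add: rt_eq)
      have wm: "tau m * rt = w m" using elim by (simp add: scaled_eq w_def)
      have "real m - dof2 \<le> real m * q m"
        using dof_minus_dof2_le elim unfolding wm rts by (simp add: q_def Q_def)
      then have "inverse (q m) \<le> overfit_coeff d (tau m) m"
        using qm dof2_less unfolding overfit_coeff_eq by (simp add: field_simps)
      then have "sigma2 * inverse (q m) \<le> overfit_coeff d (tau m) m * sigma2"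
        using sigma2 by (simp add: mult.commute)
      also have "\<dots> \<le> overfit_coeff d (tau m) m * ((1 - L 0)\<^sup>2 * fnorm_sq d beta + sigma2)"
        using overfit_coeff_gt_1 fnorm_sq_nonneg by (intro mult_left_mono) auto
      also have "\<dots> \<le> risk m" by (intro pred_risk_bounds beta sigma2)
      finally show ?case .
    qed
  qed
qed

text \<open>Eventually \<open>L 0 \<le> 1 / (1 + E)\<close> with E fixed, so
  \<open>pred_risk_le\<close> bounds the risk by the constant R.\<close>

lemma bounded_tau_limsup:
  assumes "tau \<in> O(scale)"
  shows "limsup (\<lambda>m. ereal (risk m)) < \<infinity>"
proof -
  obtain C where C: "\<forall>\<^sub>F m in sequentially. norm (tau m) \<le> C * norm (scale m)"
    using landau_o.bigE[OF assms] by blast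
  define E where "E = exp (- (C\<^sup>2 * ((2 * real (d - 1) + 1) * (2 * real (d - 1) + 1 + real d))))"
  have E: "E > 0" by (simp add: E_def)
  define R where "R = (fnorm_sq d beta + sigma2) / (1 - 1 / (1 + E))"
  have "\<forall>\<^sub>F m in sequentially. ereal (risk m) \<le> ereal R" using C ev_pos
  proof eventually_elim
    case (elim m)
    have "tau m / scale m \<le> C" using elim tau[of m] by (simp add: pos_divide_le_eq)
    note le = this
    interpret gauss_sample d "tau m" m by (rule sample) (use elim in simp)
    have "L 0 \<le> 1 / (1 + E)" unfolding E_def using elim le by (intro L_0_le_bounded_tau) (simp add: scaled_eq)
    moreover have "1 / (1 + E) < 1" using E by simp
    ultimately have "(fnorm_sq d beta + sigma2) / (1 - L 0) \<le> R"
      unfolding R_def using fnorm_sq_nonneg[of d beta] sigma2 by (intro divide_left_mono) auto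
    then show ?case using pred_risk_le[OF beta sigma2] by simp
  qed
  then have "limsup (\<lambda>m. ereal (risk m)) \<le> ereal R" by (rule Limsup_bounded)
  also have "ereal R < \<infinity>" by simp
  finally show ?thesis .
qed

end

text \<open>The constants are chosen before beta, sigma2, tau and m, hence depend on d, C1 and C2
  only; the bandwidth condition concerns the single m considered.\<close>

lemma critical_tau_lower_bound:
  assumes d: "d \<ge> 2" and C: "C1 > 0" "C2 > 0"
  shows "\<exists>eta mu :: real. eta > 0 \<and> mu > 0 \<and>
    (\<forall>beta sigma2 tau m. admissible d beta sigma2 tau \<longrightarrow> m \<ge> 1 \<longrightarrow>
      C1 * real m powr (- 1 / (real d - 1)) \<le> tau m \<longrightarrow> tau m \<le> C2 * real m powr (- 1 / (real d - 1)) \<longrightarrow>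
      pred_risk d (tau m) m beta sigma2 > mu * fnorm_sq d beta + (1 + eta) * sigma2)"
proof -
  define b where "b = C1\<^sup>2 / 2"
  define E where "E = exp (- (C2\<^sup>2 * ((2 * real (d - 1) + 1) * (2 * real (d - 1) + 1 + real d))))"
  define H where "H = 2 ^ (d - 1) * (2 * (1 + real (d - 1)) ^ (d - 1 - 1) + 2 * exp b * (1 + 1 / b) ^ (d - 1))"
  \<comment> \<open>Half of the guaranteed excess of the overfitting coefficient over 1; the other
    half makes the final inequality strict. \<open>mu\<close> is the resulting lower bound for
    \<open>(1 - L 0)\<^sup>2\<close>.\<close>
  define eta where "eta = (E / (E + H))\<^sup>2"
  define mu where "mu = (1 - 1 / (1 + E))\<^sup>2"
  have E: "E > 0" by (simp add: E_def)
  have H: "H > 0" using C by (simp add: H_def b_def add_nonneg_pos add_pos_pos)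
  have eta: "eta > 0" using E H by (simp add: eta_def)
  have mu: "mu > 0" using E by (simp add: mu_def)
  have "pred_risk d (tau m) m beta sigma2 > mu * fnorm_sq d beta + (1 + eta) * sigma2"
    if adm: "admissible d beta sigma2 tau" and m: "m \<ge> 1"
      and lo: "C1 * real m powr (- 1 / (real d - 1)) \<le> tau m"
      and hi: "tau m \<le> C2 * real m powr (- 1 / (real d - 1))" for beta sigma2 tau m
  proof -
    interpret gauss_sequence d beta sigma2 tau by (rule gauss_sequence.intro[OF d adm])
    interpret gauss_sample d "tau m" m by (rule sample) (use m in simp)
    have s: "tau m * rt = tau m / scale m" "scale m > 0" using m by (simp_all add: scaled_eq)
    have lo': "C1 \<le> tau m * rt" and hi': "tau m * rt \<le> C2"
      unfolding s(1) using s(2) lo hi by (simp_all add: pos_le_divide_eq pos_divide_le_eq)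
    have "L 0 \<le> 1 / (1 + E)" unfolding E_def by (rule L_0_le_bounded_tau[OF hi'])
    moreover have "1 / (1 + E) < 1" using E by simp
    ultimately have "mu \<le> (1 - L 0)\<^sup>2" unfolding mu_def by (intro power_mono) auto
    then have muF: "mu * fnorm_sq d beta \<le> (1 - L 0)\<^sup>2 * fnorm_sq d beta"
      by (intro mult_right_mono fnorm_sq_nonneg)
    have F: "0 \<le> mu * fnorm_sq d beta" using mu by (simp add: fnorm_sq_nonneg)
    have ov: "1 + 2 * eta \<le> overfit_coeff d (tau m) m"
      using overfit_coeff_ge_bounded_tau[OF C(1) lo' hi'] by (simp only: eta_def E_def H_def b_def)
    have "mu * fnorm_sq d beta + (1 + eta) * sigma2 < mu * fnorm_sq d beta + (1 + 2 * eta) * sigma2"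
      using eta sigma2 by simp
    also have "\<dots> \<le> (1 + 2 * eta) * (mu * fnorm_sq d beta + sigma2)"
      using mult_right_mono[of 1 "1 + 2 * eta", OF _ F] eta by (simp add: distrib_left)
    also have "\<dots> \<le> overfit_coeff d (tau m) m * ((1 - L 0)\<^sup>2 * fnorm_sq d beta + sigma2)"
      using ov muF F eta sigma2 by (intro mult_mono[OF _ add_right_mono[OF muF]]) auto
    also have "\<dots> \<le> pred_risk d (tau m) m beta sigma2" by (intro pred_risk_bounds beta sigma2)
    finally show ?thesis .
  qed
  then show ?thesis using eta mu by blast
qed

section \<open>The three regimes combined\<close>

theorem theorem1:
  fixes d :: nat
  assumes "d \<ge> 2"
  shows
  "(\<forall>beta sigma2 tau. admissible d beta sigma2 tau \<longrightarrow>
      tau \<in> o(\<lambda>m. real m powr (- 1 / (real d - 1))) \<longrightarrow>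
        ereal (null_risk d beta sigma2) \<le> liminf (\<lambda>m. ereal (pred_risk d (tau m) m beta sigma2))
      \<and> limsup (\<lambda>m. ereal (pred_risk d (tau m) m beta sigma2)) < \<infinity>)
 \<and> (\<exists>c::real. \<forall>beta sigma2 tau t. admissible d beta sigma2 tau \<longrightarrow>
      (t \<longlonglongrightarrow> 0) \<longrightarrow>
      (\<forall>m\<ge>1. tau m \<le> real m powr (- 1 / (real d - 1)) * t m) \<longrightarrow>
      (\<exists>m0. \<forall>m>m0. pred_risk d (tau m) m beta sigma2 >
          sigma2 + (1 - c * t m powr ((real d - 1) / 2)) * fnorm_sq d beta))
 \<and> (\<forall>beta sigma2 tau. admissible d beta sigma2 tau \<longrightarrow>
      tau \<in> \<omega>(\<lambda>m. real m powr (- 1 / (real d - 1))) \<longrightarrow>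
        filterlim (\<lambda>m. pred_risk d (tau m) m beta sigma2) at_top sequentially
      \<and> (\<forall>\<^sub>F m in sequentially. pred_risk d (tau m) m beta sigma2 > null_risk d beta sigma2))
 \<and> (\<forall>beta sigma2 tau. admissible d beta sigma2 tau \<longrightarrow>
      tau \<in> \<Theta>(\<lambda>m. real m powr (- 1 / (real d - 1))) \<longrightarrow>
        limsup (\<lambda>m. ereal (pred_risk d (tau m) m beta sigma2)) < \<infinity>)
 \<and> (\<forall>C1 C2 :: real. C1 > 0 \<longrightarrow> C2 > 0 \<longrightarrow>
      (\<exists>eta mu :: real. eta > 0 \<and> mu > 0 \<and>
        (\<forall>beta sigma2 tau. admissible d beta sigma2 tau \<longrightarrow>
          (\<forall>m\<ge>1. C1 * real m powr (- 1 / (real d - 1)) \<le> tau m \<and>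
                    tau m \<le> C2 * real m powr (- 1 / (real d - 1))) \<longrightarrow>
            (\<forall>m\<ge>1. pred_risk d (tau m) m beta sigma2 >
                      mu * fnorm_sq d beta + (1 + eta) * sigma2)
          \<and> (sigma2 > (1 - mu) / eta * fnorm_sq d beta \<longrightarrow>
               (\<forall>m\<ge>1. pred_risk d (tau m) m beta sigma2 > null_risk d beta sigma2)))))"
proof (intro conjI allI impI)
  fix beta :: "nat \<Rightarrow> nat \<Rightarrow> real" and sigma2 :: real and tau :: "nat \<Rightarrow> real"
  assume adm: "admissible d beta sigma2 tau"
  interpret gauss_sequence d beta sigma2 tau by (rule gauss_sequence.intro[OF assms adm])
  assume "tau \<in> o(\<lambda>m. real m powr (- 1 / (real d - 1)))"
  then have "(\<lambda>m. ereal (risk m)) \<longlonglongrightarrow> ereal (null_risk d beta sigma2)"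
    by (intro tendsto_intros small_tau_tendsto)
  then have "liminf (\<lambda>m. ereal (risk m)) = ereal (null_risk d beta sigma2)"
    "limsup (\<lambda>m. ereal (risk m)) = ereal (null_risk d beta sigma2)"
    by (auto intro: lim_imp_Liminf lim_imp_Limsup)
  then show "ereal (null_risk d beta sigma2) \<le> liminf (\<lambda>m. ereal (risk m))"
    "limsup (\<lambda>m. ereal (risk m)) < \<infinity>" by simp_all
next
  show "\<exists>c::real. \<forall>beta sigma2 tau t. admissible d beta sigma2 tau \<longrightarrow>
      (t \<longlonglongrightarrow> 0) \<longrightarrow>
      (\<forall>m\<ge>1. tau m \<le> real m powr (- 1 / (real d - 1)) * t m) \<longrightarrow>
      (\<exists>m0. \<forall>m>m0. pred_risk d (tau m) m beta sigma2 >
          sigma2 + (1 - c * t m powr ((real d - 1) / 2)) * fnorm_sq d beta)"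
    using gauss_sequence.small_tau_rate[OF gauss_sequence.intro[OF assms]]
    by (intro exI[of _ "2 * (real (d - 1) ^ (d - 1) * exp (1 + real d))"] allI impI)
next
  fix beta :: "nat \<Rightarrow> nat \<Rightarrow> real" and sigma2 :: real and tau :: "nat \<Rightarrow> real"
  assume adm: "admissible d beta sigma2 tau"
  interpret gauss_sequence d beta sigma2 tau by (rule gauss_sequence.intro[OF assms adm])
  assume "tau \<in> \<omega>(\<lambda>m. real m powr (- 1 / (real d - 1)))"
  then show lim: "filterlim risk at_top sequentially" by (rule large_tau_tendsto)
  then show "\<forall>\<^sub>F m in sequentially. risk m > null_risk d beta sigma2"
    by (simp add: filterlim_at_top_dense)
next
  fix beta :: "nat \<Rightarrow> nat \<Rightarrow> real" and sigma2 :: real and tau :: "nat \<Rightarrow> real"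
  assume adm: "admissible d beta sigma2 tau"
  interpret gauss_sequence d beta sigma2 tau by (rule gauss_sequence.intro[OF assms adm])
  assume "tau \<in> \<Theta>(\<lambda>m. real m powr (- 1 / (real d - 1)))"
  then show "limsup (\<lambda>m. ereal (risk m)) < \<infinity>"
    by (intro bounded_tau_limsup bigthetaD1)
next
  fix C1 C2 :: real
  assume C: "C1 > 0" "C2 > 0"
  from critical_tau_lower_bound[OF assms C] obtain eta mu :: real
    where eta: "eta > 0" and mu: "mu > 0"
      and gt: "\<And>beta sigma2 tau m. \<lbrakk>admissible d beta sigma2 tau; m \<ge> 1;
        C1 * real m powr (- 1 / (real d - 1)) \<le> tau m; tau m \<le> C2 * real m powr (- 1 / (real d - 1))\<rbrakk>
        \<Longrightarrow> pred_risk d (tau m) m beta sigma2 > mu * fnorm_sq d beta + (1 + eta) * sigma2"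
    by blast
  \<comment> \<open>The threshold on sigma2 says
    \<open>(1 - mu) * fnorm_sq d beta < eta * sigma2\<close>, which is exactly when the lower bound
    exceeds the null risk.\<close>
  have null: "null_risk d beta sigma2 < mu * fnorm_sq d beta + (1 + eta) * sigma2"
    if "sigma2 > (1 - mu) / eta * fnorm_sq d beta" for beta sigma2
  proof -
    have "(1 - mu) * fnorm_sq d beta < eta * sigma2" using that eta by (simp add: field_simps)
    then show ?thesis by (simp add: null_risk_def algebra_simps)
  qed
  show "\<exists>eta mu :: real. eta > 0 \<and> mu > 0 \<and>
        (\<forall>beta sigma2 tau. admissible d beta sigma2 tau \<longrightarrow>
          (\<forall>m\<ge>1. C1 * real m powr (- 1 / (real d - 1)) \<le> tau m \<and>
                    tau m \<le> C2 * real m powr (- 1 / (real d - 1))) \<longrightarrow>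
            (\<forall>m\<ge>1. pred_risk d (tau m) m beta sigma2 >
                      mu * fnorm_sq d beta + (1 + eta) * sigma2)
          \<and> (sigma2 > (1 - mu) / eta * fnorm_sq d beta \<longrightarrow>
               (\<forall>m\<ge>1. pred_risk d (tau m) m beta sigma2 > null_risk d beta sigma2)))"
  proof (rule exI[of _ eta], rule exI[of _ mu], intro conjI allI impI eta mu)
    fix beta :: "nat \<Rightarrow> nat \<Rightarrow> real" and sigma2 :: real and tau :: "nat \<Rightarrow> real" and m :: nat
    assume adm: "admissible d beta sigma2 tau" and m: "m \<ge> 1"
      and tau: "\<forall>m\<ge>1. C1 * real m powr (- 1 / (real d - 1)) \<le> tau m \<and>
        tau m \<le> C2 * real m powr (- 1 / (real d - 1))"
    show risk: "pred_risk d (tau m) m beta sigma2 > mu * fnorm_sq d beta + (1 + eta) * sigma2"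
      by (rule gt[OF adm m]) (use tau m in auto)
    assume "sigma2 > (1 - mu) / eta * fnorm_sq d beta"
    from null[OF this] risk
    show "pred_risk d (tau m) m beta sigma2 > null_risk d beta sigma2" by (rule less_trans)
  qed
qed

end
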